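(* Let $K$ be an infinite field with $\mathrm{char}(K)=2$ and let $Q\in\mathcal{Q}(n,d,m)$. If $h$ is a closed path in $Q$ with $h\not\equiv0$, then $\deg(h)\leq m(d-n-1)+2n$.
   Context: A quiver $Q$ is a finite oriented graph; for an arrow $a$, $a''$ is its tail and $a'$ its head. A path $a=a_1\cdots a_s$ ($a_i$ arrows) satisfies $a_i'=a_{i+1}''$; it is closed (in the vertex $a_1''$) if $a_1''=a_s'$; $\deg(a)=s$, $V(a)=\{a_1'',a_1',\dots,a_s'\}$. A closed path is primitive if each vertex of $V(a)$ is the head of exactly one $a_i$. $m(Q)$ is the maximal degree of a primitive closed path; $Q$ is strongly connected if some closed path contains all vertices; $\mathcal{Q}(n,d,m)$ is the set of strongly connected quivers with $n$ vertices, $d$ arrows and $m(Q)=m$. Closed paths are incident if they are closed in the same vertex. The equivalence $\equiv$ (for $\mathrm{char}(K)=2$) is the equivalence relation on the set of closed paths of $Q$ together with the symbol $0$ generated by: (1) $ab\equiv ba$ for paths $a,b$ such that $ab$ is a closed path; (2) $a_{\sigma(1)}\cdots a_{\sigma(t)}\equiv a_1\cdots a_t$ for incident closed paths $a_1,\dots,a_t$, $t\geq2$, $\sigma\in S_t$ (signs are irrelevant in characteristic 2); (3) $a_1^2a_2\equiv0$ for incident closed paths $a_1,a_2$; (4) $a_1^2\equiv0$ for every closed path $a_1$. *)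

theory Defs
  imports Main "HOL-Combinatorics.Permutations"
begin

definition quiver :: "'v set \<Rightarrow> 'a set \<Rightarrow> ('a \<Rightarrow> 'v) \<Rightarrow> ('a \<Rightarrow> 'v) \<Rightarrow> bool" where
  "quiver V A src tgt \<longleftrightarrow> finite V \<and> finite A \<and> src ` A \<subseteq> V \<and> tgt ` A \<subseteq> V"

definition is_path :: "'a set \<Rightarrow> ('a \<Rightarrow> 'v) \<Rightarrow> ('a \<Rightarrow> 'v) \<Rightarrow> 'a list \<Rightarrow> bool" where
  "is_path A src tgt p \<longleftrightarrow> p \<noteq> [] \<and> set p \<subseteq> A \<and>
     (\<forall>i. Suc i < length p \<longrightarrow> tgt (p ! i) = src (p ! Suc i))"

definition closed_path :: "'a set \<Rightarrow> ('a \<Rightarrow> 'v) \<Rightarrow> ('a \<Rightarrow> 'v) \<Rightarrow> 'a list \<Rightarrow> bool" where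
  "closed_path A src tgt p \<longleftrightarrow> is_path A src tgt p \<and> src (hd p) = tgt (last p)"

definition path_verts :: "('a \<Rightarrow> 'v) \<Rightarrow> ('a \<Rightarrow> 'v) \<Rightarrow> 'a list \<Rightarrow> 'v set" where
  "path_verts src tgt p = insert (src (hd p)) (tgt ` set p)"

definition primitive_closed_path :: "'a set \<Rightarrow> ('a \<Rightarrow> 'v) \<Rightarrow> ('a \<Rightarrow> 'v) \<Rightarrow> 'a list \<Rightarrow> bool" where
  "primitive_closed_path A src tgt p \<longleftrightarrow> closed_path A src tgt p \<and>
     (\<forall>v \<in> path_verts src tgt p. card {i. i < length p \<and> tgt (p ! i) = v} = 1)"

definition mQ :: "'a set \<Rightarrow> ('a \<Rightarrow> 'v) \<Rightarrow> ('a \<Rightarrow> 'v) \<Rightarrow> nat" where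
  "mQ A src tgt = Max (length ` {p. primitive_closed_path A src tgt p})"

definition strongly_connected :: "'v set \<Rightarrow> 'a set \<Rightarrow> ('a \<Rightarrow> 'v) \<Rightarrow> ('a \<Rightarrow> 'v) \<Rightarrow> bool" where
  "strongly_connected V A src tgt \<longleftrightarrow>
     (\<exists>p. closed_path A src tgt p \<and> V \<subseteq> path_verts src tgt p)"

definition in_Qndm :: "'v set \<Rightarrow> 'a set \<Rightarrow> ('a \<Rightarrow> 'v) \<Rightarrow> ('a \<Rightarrow> 'v) \<Rightarrow> nat \<Rightarrow> nat \<Rightarrow> nat \<Rightarrow> bool" where
  "in_Qndm V A src tgt n d m \<longleftrightarrow> quiver V A src tgt \<and> strongly_connected V A src tgt \<and>
     card V = n \<and> card A = d \<and> mQ A src tgt = m"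

text \<open>Generating relations of \<equiv> on closed paths together with 0 (None = 0).\<close>
inductive equiv_gen :: "'a set \<Rightarrow> ('a \<Rightarrow> 'v) \<Rightarrow> ('a \<Rightarrow> 'v) \<Rightarrow> 'a list option \<Rightarrow> 'a list option \<Rightarrow> bool"
  for A src tgt where
  rot: "\<lbrakk>a \<noteq> []; b \<noteq> []; closed_path A src tgt (a @ b)\<rbrakk>
        \<Longrightarrow> equiv_gen A src tgt (Some (a @ b)) (Some (b @ a))"
| perm: "\<lbrakk>length as \<ge> 2; \<forall>x \<in> set as. closed_path A src tgt x \<and> src (hd x) = v;
          \<sigma> permutes {..<length as}\<rbrakk>
        \<Longrightarrow> equiv_gen A src tgt (Some (concat (map (\<lambda>i. as ! \<sigma> i) [0..<length as])))
                                 (Some (concat as))"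
| sq2: "\<lbrakk>closed_path A src tgt a1; closed_path A src tgt a2; src (hd a1) = src (hd a2)\<rbrakk>
        \<Longrightarrow> equiv_gen A src tgt (Some (a1 @ a1 @ a2)) None"
| sq: "closed_path A src tgt a1 \<Longrightarrow> equiv_gen A src tgt (Some (a1 @ a1)) None"

definition path_equiv :: "'a set \<Rightarrow> ('a \<Rightarrow> 'v) \<Rightarrow> ('a \<Rightarrow> 'v) \<Rightarrow> 'a list option \<Rightarrow> 'a list option \<Rightarrow> bool" where
  "path_equiv A src tgt = equivclp (equiv_gen A src tgt)"

end

theory Submission
  imports Defs
begin

text \<open>
  Call a closed path zero if rotations and swaps of incident closed paths turn it into
  \<open>a a c\<close> with \<open>a\<close>, \<open>c\<close> incident. Let \<open>r\<close> be the
  cyclomatic number of the support of a nonzero closed path \<open>h\<close>. By induction on the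
  length, the number of visits to vertices beyond the second visit is at most \<open>m (r - 2)\<close>
  if \<open>r \<ge> 2\<close>, and no vertex is visited twice if \<open>r = 1\<close>. Since
  \<open>r \<le> d - n + 1\<close>, summing the visits over all vertices gives the bound.

  If \<open>h\<close> is not primitive, then \<open>h \<equiv> c b\<close> with \<open>c\<close>
  primitive and containing an arrow that does not occur in \<open>b\<close>. Otherwise \<open>h\<close>
  could be written as a closed path \<open>R\<close> followed by two copies of a cycle with closed paths
  inserted, and \<open>R\<close> could always be made longer. If \<open>b\<close> is nonzero, induction applies
  to it. If \<open>b\<close> is zero, then \<open>b\<close> contains a primitive cycle \<open>w\<close> twice,
  with \<open>c\<close> and the rest of \<open>b\<close> attached to \<open>w\<close> at disjoint sets of vertices;
  removing \<open>c\<close> and one copy of \<open>w\<close> leaves a nonzero closed path.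
\<close>

section \<open>Walks, their cuts and their primitive factors\<close>

locale quiver_maps =
  fixes src tgt :: "'a \<Rightarrow> 'v"
begin

text \<open>With both ends recorded, the empty list is a closed walk at every vertex, so cuts may
  leave empty pieces.\<close>

fun walk :: "'v \<Rightarrow> 'a list \<Rightarrow> 'v \<Rightarrow> bool" where
  "walk u [] v \<longleftrightarrow> u = v"
| "walk u (x # p) v \<longleftrightarrow> src x = u \<and> walk (tgt x) p v"

lemma walk_append: "walk u (p @ q) v \<longleftrightarrow> (\<exists>z. walk u p z \<and> walk z q v)"
  by (induction p arbitrary: u) auto

lemma walk_appI: "walk u p z \<Longrightarrow> walk z q v \<Longrightarrow> walk u (p @ q) v"
  by (auto simp: walk_append)

lemma walk_end_unique: "walk u p v \<Longrightarrow> walk u p v' \<Longrightarrow> v = v'"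
  by (induction p arbitrary: u) auto

lemma walk_unique:
  assumes "p \<noteq> []" "walk u p v" "walk u' p v'"
  shows "u = u'" "v = v'"
proof -
  show "u = u'" using assms by (cases p) auto
  then show "v = v'" using assms walk_end_unique by blast
qed

lemma walk_append_drop: "walk u p z \<Longrightarrow> walk u (p @ q) v \<Longrightarrow> walk z q v"
  by (metis walk_append walk_end_unique)

lemma walk_cut:
  assumes "walk s p s'" "v \<in> src ` set p"
  obtains p1 p2 where "p = p1 @ p2" "walk s p1 v" "walk v p2 s'"
proof -
  obtain p1 x p2 where "p = p1 @ x # p2" "src x = v" using assms(2) by (metis imageE split_list)
  with assms(1) show ?thesis using that[of p1 "x # p2"] by (auto simp: walk_append)
qed

text \<open>On a closed walk the end vertex is also the source of the first arrow, so the sources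
  already include every visited vertex.\<close>

lemma cut_in_srcs:
  assumes "walk s p1 v" "walk v p2 s" "p1 @ p2 \<noteq> []"
  shows "v \<in> src ` set (p1 @ p2)"
proof (cases p2)
  case Nil
  then have "walk v p1 v" "p1 \<noteq> []" using assms by auto
  then show ?thesis by (cases p1) auto
next
  case (Cons x q)
  then show ?thesis using assms by auto
qed

text \<open>Two arrows with the same source bound the closed factor \<open>g\<close>. The second of
  them starts \<open>q\<close>, so \<open>g\<close> is a proper factor.\<close>

lemma nondistinct_factor:
  assumes "walk u p v" "\<not> distinct (map src p)"
  obtains s g q z where "p = s @ g @ q" "walk u s z" "walk z g z" "walk z q v" "g \<noteq> []" "q \<noteq> []"
proof -
  obtain xs ys zs y where "map src p = xs @ [y] @ ys @ [y] @ zs"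
    using not_distinct_decomp[OF assms(2)] by auto
  then obtain s p' where 1: "p = s @ p'" "map src p' = y # ys @ y # zs"
    by (auto simp: map_eq_append_conv)
  then obtain x p'' where 2: "p' = x # p''" "src x = y" "map src p'' = ys @ y # zs" by auto
  then obtain g x' q where 3: "p'' = g @ x' # q" "src x' = y"
    by (auto simp: map_eq_append_conv)
  have "walk u s y" "walk y (x # g) y" "walk y (x' # q) v"
    using assms(1) 1 2 3 by (auto simp: walk_append)
  then show ?thesis using that[of s "x # g" "x' # q" y] 1 2 3 by auto
qed

lemma primitive_factor:
  assumes "walk v l v" "l \<noteq> []"
  obtains \<alpha> c \<beta> t where "l = \<alpha> @ c @ \<beta>" "walk v \<alpha> t" "walk t c t" "walk t \<beta> v" "c \<noteq> []"
    "distinct (map src c)"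
proof -
  have "\<exists>\<alpha> c \<beta> t. l = \<alpha> @ c @ \<beta> \<and> walk v \<alpha> t \<and> walk t c t \<and> walk t \<beta> v \<and> c \<noteq> [] \<and> distinct (map src c)"
    using assms
  proof (induction l arbitrary: v rule: length_induct)
    case (1 l)
    show ?case
    proof (cases "distinct (map src l)")
      case True
      then show ?thesis using 1 by (intro exI[of _ "[]"] exI[of _ l] exI[of _ v]) auto
    next
      case False
      then obtain s g q z where l: "l = s @ g @ q" "walk v s z" "walk z g z" "walk z q v" "g \<noteq> []" "q \<noteq> []"
        using nondistinct_factor 1 by metis
      then obtain \<alpha> c \<beta> t where g: "g = \<alpha> @ c @ \<beta>" "walk z \<alpha> t" "walk t c t" "walk t \<beta> z" "c \<noteq> []"
         "distinct (map src c)"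
        using 1(1) by (metis (no_types, lifting) add_less_cancel_left length_append length_greater_0_conv
            less_add_same_cancel1 trans_less_add2)
      have "l = (s @ \<alpha>) @ c @ (\<beta> @ q)" using l g by simp
      moreover have "walk v (s @ \<alpha>) t" "walk t (\<beta> @ q) v" using l g by (auto intro: walk_appI)
      ultimately show ?thesis using g by blast
    qed
  qed
  then show ?thesis using that by blast
qed

section \<open>Equivalence generated by rotations and swaps\<close>

inductive eqv :: "'a list \<Rightarrow> 'a list \<Rightarrow> bool" where
  eqv_rot: "walk v (a @ b) v \<Longrightarrow> eqv (a @ b) (b @ a)"
| eqv_swap: "walk v a v \<Longrightarrow> walk v b v \<Longrightarrow> walk v c v \<Longrightarrow> eqv (a @ b @ c) (b @ a @ c)"
| eqv_trans [trans]: "eqv a b \<Longrightarrow> eqv b c \<Longrightarrow> eqv a c"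

lemma eqv_refl: "walk v a v \<Longrightarrow> eqv a a"
  using eqv_rot[of v a "[]"] by simp

lemma eqv_sym: "eqv a b \<Longrightarrow> eqv b a"
proof (induction rule: eqv.induct)
  case (eqv_rot v a b)
  then obtain z where "walk v a z" "walk z b v" by (auto simp: walk_append)
  then show ?case using eqv.eqv_rot[of z b a] by (auto simp: walk_append)
next
  case (eqv_swap v a b c)
  then show ?case using eqv.eqv_swap by blast
next
  case (eqv_trans a b c)
  then show ?case using eqv.eqv_trans by blast
qed

lemma eqv_mset: "eqv a b \<Longrightarrow> mset a = mset b"
  by (induction rule: eqv.induct) auto

lemma eqv_set: "eqv a b \<Longrightarrow> set a = set b"
  using eqv_mset mset_eq_setD by blast

lemma eqv_length: "eqv a b \<Longrightarrow> length a = length b"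
  using eqv_mset mset_eq_length by blast

lemma eqv_closed: "eqv a b \<Longrightarrow> \<exists>v. walk v b v"
proof (induction rule: eqv.induct)
  case (eqv_rot v a b)
  then show ?case by (auto simp: walk_append)
qed (auto intro: walk_appI)

lemma eqv_rot2: "walk u a z \<Longrightarrow> walk z b u \<Longrightarrow> eqv (a @ b) (b @ a)"
  by (auto intro: eqv_rot walk_appI)

lemma eqv_swap_mid:
  assumes "walk z P v" "walk v a v" "walk v b v" "walk v S z"
  shows "eqv (P @ a @ b @ S) (P @ b @ a @ S)"
proof -
  have "eqv (P @ a @ b @ S) ((a @ b @ S) @ P)"
    using eqv_rot2[of z P v "a @ b @ S"] assms by (simp add: walk_appI)
  also have "eqv ((a @ b @ S) @ P) (b @ a @ S @ P)"
    using eqv_swap[of v a b "S @ P"] assms by (simp add: walk_appI)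
  also have "eqv (b @ a @ S @ P) (P @ b @ a @ S)"
    using eqv_rot2[of v "b @ a @ S" z P] assms by (simp add: walk_appI)
  finally show ?thesis .
qed

text \<open>This change of base point is behind most rearrangements below. A swap at
  \<open>p\<close> and a swap at \<open>v\<close> regroup the pieces, and one rotation then moves
  the base to \<open>p\<close>.\<close>

lemma eqv_rebase3:
  assumes a: "walk v a1 p" "walk p a2 v" and b: "walk v b1 p" "walk p b2 v"
    and c: "walk v c1 p" "walk p c2 v"
  shows "eqv (a1 @ a2 @ b1 @ b2 @ c1 @ c2) (a2 @ a1 @ b2 @ b1 @ c2 @ c1)"
proof -
  have "eqv (a1 @ a2 @ b1 @ b2 @ c1 @ c2) (a1 @ b2 @ c1 @ a2 @ b1 @ c2)"
    by (rule eqv_swap_mid[OF a(1) walk_appI[OF a(2) b(1)] walk_appI[OF b(2) c(1)] c(2), unfolded append_assoc])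
  also have "eqv (a1 @ b2 @ c1 @ a2 @ b1 @ c2) (c1 @ a2 @ a1 @ b2 @ b1 @ c2)"
    by (rule eqv_swap[OF walk_appI[OF a(1) b(2)] walk_appI[OF c(1) a(2)] walk_appI[OF b(1) c(2)],
          unfolded append_assoc])
  also have "eqv (c1 @ a2 @ a1 @ b2 @ b1 @ c2) (a2 @ a1 @ b2 @ b1 @ c2 @ c1)"
    using eqv_rot2[of v c1 p "a2 @ a1 @ b2 @ b1 @ c2"] a b c by (simp add: walk_appI)
  finally show ?thesis .
qed

text \<open>The segment between two visits of \<open>v\<close> is itself a closed walk at
  \<open>v\<close>, so it can be swapped with \<open>c\<close>.\<close>

lemma eqv_insert_same:
  assumes "\<beta>1 @ \<beta>2 = \<gamma>1 @ \<gamma>2" "\<beta>1 @ \<beta>2 \<noteq> []" "walk s \<beta>1 v" "walk v \<beta>2 s" "walk s' \<gamma>1 v" "walk v \<gamma>2 s'"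
    "walk v c v"
  shows "eqv (\<beta>1 @ c @ \<beta>2) (\<gamma>1 @ c @ \<gamma>2)"
proof -
  have s: "s = s'"
    using walk_unique(1)[OF assms(2) walk_appI[OF assms(3,4)]] walk_appI[OF assms(5,6)] assms(1) by simp
  have *: "eqv (\<beta>1 @ c @ us @ \<beta>2) (\<beta>1 @ us @ c @ \<beta>2)"
    if "walk s \<beta>1 v" "walk s (\<beta>1 @ us) v" "walk v \<beta>2 s" for \<beta>1 us \<beta>2
    using eqv_swap_mid[OF that(1) assms(7) _ that(3), of us] that walk_append_drop by blast
  from assms(1) obtain us where "\<beta>1 = \<gamma>1 @ us \<and> us @ \<beta>2 = \<gamma>2 \<or> \<beta>1 @ us = \<gamma>1 \<and> \<beta>2 = us @ \<gamma>2"
    by (auto simp: append_eq_append_conv2)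
  then show ?thesis
    using *[of \<gamma>1 us \<beta>2] *[of \<beta>1 us \<gamma>2] assms s eqv_sym by auto
qed

text \<open>Inserting \<open>c\<close> at \<open>v\<close> is well defined on equivalence classes:
  \<open>c\<close> travels with the block in which it sits, and \<open>eqv_insert_same\<close>
  absorbs the choice of the visit.\<close>

lemma eqv_insert:
  assumes "eqv b b'" "b \<noteq> []" "b = \<beta>1 @ \<beta>2" "walk s \<beta>1 v" "walk v \<beta>2 s"
    "b' = \<gamma>1 @ \<gamma>2" "walk s' \<gamma>1 v" "walk v \<gamma>2 s'" and c: "walk v c v"
  shows "eqv (\<beta>1 @ c @ \<beta>2) (\<gamma>1 @ c @ \<gamma>2)"
  using assms(1-8)
proof (induction arbitrary: \<beta>1 \<beta>2 s \<gamma>1 \<gamma>2 s' rule: eqv.induct)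
  case (eqv_rot z a b)
  have ne: "b @ a \<noteq> []" using eqv_rot.prems by auto
  have wab: "walk s (a @ b) s" using eqv_rot.prems by (metis walk_appI)
  from eqv_rot.prems(2) obtain us where "a = \<beta>1 @ us \<and> us @ b = \<beta>2 \<or> a @ us = \<beta>1 \<and> b = us @ \<beta>2"
    by (auto simp: append_eq_append_conv2)
  then show ?case
  proof
    assume u: "a = \<beta>1 @ us \<and> us @ b = \<beta>2"
    then have "walk v (us @ b) s" using eqv_rot.prems by simp
    then obtain y where y: "walk v us y" "walk y b s" unfolding walk_append by blast
    have "eqv (\<beta>1 @ c @ \<beta>2) (b @ \<beta>1 @ c @ us)"
      using eqv_rot2[of s "\<beta>1 @ c @ us" y b] u y eqv_rot.prems c by (simp add: walk_appI)
    moreover have "eqv ((b @ \<beta>1) @ c @ us) (\<gamma>1 @ c @ \<gamma>2)"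
      using eqv_rot.prems u y ne c
      by (intro eqv_insert_same[where s=y and v=v and s'=s']) (auto intro: walk_appI)
    ultimately show ?thesis using eqv.eqv_trans by auto
  next
    assume u: "a @ us = \<beta>1 \<and> b = us @ \<beta>2"
    then have "walk s (a @ us) v" using eqv_rot.prems by simp
    then obtain y where y: "walk s a y" "walk y us v" unfolding walk_append by blast
    have "eqv (\<beta>1 @ c @ \<beta>2) (us @ c @ \<beta>2 @ a)"
      using eqv_rot2[of s a y "us @ c @ \<beta>2"] u y eqv_rot.prems c by (auto simp: walk_appI)
    also have "eqv (us @ c @ \<beta>2 @ a) (\<gamma>1 @ c @ \<gamma>2)"
      using eqv_rot.prems u y ne c
      by (intro eqv_insert_same[where s=y and v=v and s'=s']) (auto intro: walk_appI)
    finally show ?thesis .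
  qed
next
  case (eqv_swap z a b e)
  have ne: "b @ a @ e \<noteq> []" using eqv_swap.prems by auto
  have "walk s (a @ b @ e) s" using eqv_swap.prems by (metis walk_appI)
  then have s: "s = z" using walk_unique(1) eqv_swap by (metis walk_appI)
  \<comment> \<open>It suffices to reach some insertion of \<open>c\<close> into the swapped walk,
    whatever the visit.\<close>
  have fin: "eqv (\<delta>1 @ c @ \<delta>2) (\<gamma>1 @ c @ \<gamma>2)"
    if "\<delta>1 @ \<delta>2 = b @ a @ e" "walk z \<delta>1 v" "walk v \<delta>2 z" for \<delta>1 \<delta>2
    using that eqv_swap.prems ne c by (intro eqv_insert_same[where s=z and v=v and s'=s']) auto
  from eqv_swap.prems(2) obtain us where
    "a = \<beta>1 @ us \<and> us @ b @ e = \<beta>2 \<or> a @ us = \<beta>1 \<and> b @ e = us @ \<beta>2"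
    by (auto simp: append_eq_append_conv2)
  then show ?case
  proof
    assume u: "a = \<beta>1 @ us \<and> us @ b @ e = \<beta>2"
    then have us: "walk v us z" using eqv_swap.hyps(1) eqv_swap.prems s walk_append_drop by blast
    have "eqv (\<beta>1 @ c @ \<beta>2) (b @ \<beta>1 @ c @ us @ e)"
      using eqv.eqv_swap[of z "\<beta>1 @ c @ us" b e] u us eqv_swap s c by (auto simp: walk_appI)
    moreover have "eqv ((b @ \<beta>1) @ c @ (us @ e)) (\<gamma>1 @ c @ \<gamma>2)"
      using u us eqv_swap s by (intro fin) (auto intro: walk_appI)
    ultimately show ?thesis using eqv.eqv_trans by auto
  next
    assume u: "a @ us = \<beta>1 \<and> b @ e = us @ \<beta>2"
    then have us: "walk z us v" using eqv_swap.hyps(1) eqv_swap.prems s walk_append_drop by blast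
    from u obtain ws where "b = us @ ws \<and> ws @ e = \<beta>2 \<or> b @ ws = us \<and> e = ws @ \<beta>2"
      by (auto simp: append_eq_append_conv2)
    then show ?thesis
    proof
      assume w: "b = us @ ws \<and> ws @ e = \<beta>2"
      then have ws: "walk v ws z" using eqv_swap.hyps(2) us walk_append_drop by blast
      have "eqv (\<beta>1 @ c @ \<beta>2) (us @ c @ ws @ a @ e)"
        using eqv.eqv_swap[of z a "us @ c @ ws" e] u w us ws eqv_swap s c by (auto simp: walk_appI)
      also have "eqv (us @ c @ (ws @ a @ e)) (\<gamma>1 @ c @ \<gamma>2)"
        using u w us ws eqv_swap s by (intro fin) (auto intro: walk_appI)
      finally show ?thesis .
    next
      assume w: "b @ ws = us \<and> e = ws @ \<beta>2"
      then have ws: "walk z ws v" using eqv_swap.hyps(2) us walk_append_drop by blast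
      have "eqv (\<beta>1 @ c @ \<beta>2) (b @ a @ ws @ c @ \<beta>2)"
        using eqv.eqv_swap[of z a b "ws @ c @ \<beta>2"] u w us ws eqv_swap s c by (auto simp: walk_appI)
      moreover have "eqv ((b @ a @ ws) @ c @ \<beta>2) (\<gamma>1 @ c @ \<gamma>2)"
        using u w us ws eqv_swap s by (intro fin) (auto intro: walk_appI)
      ultimately show ?thesis using eqv.eqv_trans by auto
    qed
  qed
next
  case (eqv_trans a b d)
  have ne: "b \<noteq> []" using eqv_length[OF eqv_trans.hyps(1)] eqv_trans.prems(1) by auto
  obtain y where y: "walk y b y" using eqv_closed[OF eqv_trans.hyps(1)] by blast
  \<comment> \<open>The intermediate walk has the same arrows and hence also visits
    \<open>v\<close>; any such visit serves for both halves.\<close>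
  have "v \<in> src ` set b"
    using cut_in_srcs[of s \<beta>1 v \<beta>2] eqv_trans.prems eqv_set[OF eqv_trans.hyps(1)] by auto
  then obtain \<delta>1 \<delta>2 where d: "b = \<delta>1 @ \<delta>2" "walk y \<delta>1 v" "walk v \<delta>2 y"
    using walk_cut[OF y] by metis
  show ?case
    using eqv.eqv_trans[OF eqv_trans.IH(1)[OF eqv_trans.prems(1-4) d] eqv_trans.IH(2)[OF ne d eqv_trans.prems(5-7)]] .
qed

section \<open>Closed walks that contain a square up to equivalence\<close>

text \<open>Since \<open>c\<close> may be empty, relations (3) and (4) are both covered.\<close>

definition zero :: "'a list \<Rightarrow> bool" where
  "zero h \<longleftrightarrow> (\<exists>v a c. a \<noteq> [] \<and> walk v a v \<and> walk v c v \<and> eqv h (a @ a @ c))"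

lemma zero_eqv: "eqv h h' \<Longrightarrow> zero h' \<Longrightarrow> zero h"
  unfolding zero_def using eqv_trans by blast

lemma zero_square:
  assumes "walk z P p" "walk p g p" "walk p S z" "g \<noteq> []"
  shows "zero (P @ g @ g @ S)"
proof -
  have "eqv (P @ g @ g @ S) (g @ g @ S @ P)"
    using eqv_rot2[of z P p "g @ g @ S"] assms by (simp add: walk_appI)
  then show ?thesis unfolding zero_def using assms walk_appI by blast
qed

subsection \<open>Closed walks inserted into a walk\<close>

text \<open>\<open>ys\<close> arises from the walk \<open>xs\<close> by inserting (possibly empty) closed walks at its vertices.\<close>
fun loopy :: "'v \<Rightarrow> 'a list \<Rightarrow> 'a list \<Rightarrow> 'v \<Rightarrow> bool" where
  "loopy u [] ys v \<longleftrightarrow> u = v \<and> walk u ys u"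
| "loopy u (x # xs) ys v \<longleftrightarrow>
     (\<exists>l ys'. ys = l @ x # ys' \<and> src x = u \<and> walk u l u \<and> loopy (tgt x) xs ys' v)"

lemma loopy_ConsI:
  "src x = u \<Longrightarrow> walk u l u \<Longrightarrow> loopy (tgt x) xs ys v \<Longrightarrow> loopy u (x # xs) (l @ x # ys) v"
  by auto

lemma loopy_ConsI0: "src x = u \<Longrightarrow> loopy (tgt x) xs ys v \<Longrightarrow> loopy u (x # xs) (x # ys) v"
  using loopy_ConsI[of x u "[]"] by simp

lemma loopy_walk: "loopy u xs ys v \<Longrightarrow> walk u ys v"
  by (induction xs arbitrary: u ys) (auto simp: walk_append)

lemma loopy_skeleton_walk: "loopy u xs ys v \<Longrightarrow> walk u xs v"
  by (induction xs arbitrary: u ys) auto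

lemma loopy_refl: "walk u xs v \<Longrightarrow> loopy u xs xs v"
  by (induction xs arbitrary: u) (auto intro: loopy_ConsI0 simp del: loopy.simps(2))

lemma loopy_prepend: "walk u l u \<Longrightarrow> loopy u b B v \<Longrightarrow> loopy u b (l @ B) v"
proof (cases b)
  case (Cons x xs)
  assume a: "walk u l u" "loopy u b B v"
  then obtain l' B' where "B = l' @ x # B'" "src x = u" "walk u l' u" "loopy (tgt x) xs B' v"
    using Cons by auto
  moreover from this have "l @ B = (l @ l') @ x # B'" "walk u (l @ l') u" using a by (auto intro: walk_appI)
  ultimately show ?thesis using Cons by (metis loopy_ConsI)
qed (auto intro: walk_appI)

lemma loopy_append: "loopy u a A z \<Longrightarrow> loopy z b B v \<Longrightarrow> loopy u (a @ b) (A @ B) v"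
proof (induction a arbitrary: u A)
  case Nil
  then show ?case using loopy_prepend by auto
next
  case (Cons x a)
  then obtain l A' where A: "A = l @ x # A'" "src x = u" "walk u l u" "loopy (tgt x) a A' z" by auto
  with Cons.IH[OF A(4) Cons.prems(2)] show ?case using loopy_ConsI by fastforce
qed

lemma loopy_join:
  "loopy u a A p \<Longrightarrow> walk p l p \<Longrightarrow> loopy p b B v \<Longrightarrow> loopy u (a @ b) (A @ l @ B) v"
  by (simp add: loopy_append loopy_prepend)

lemma loopy_split:
  "loopy u (a @ b) C v \<Longrightarrow> \<exists>A B z. C = A @ B \<and> loopy u a A z \<and> loopy z b B v"
proof (induction a arbitrary: u C)
  case Nil
  then show ?case by - (rule exI[of _ "[]"], rule exI[of _ C], rule exI[of _ u], auto)
next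
  case (Cons x a)
  then obtain l C' where C: "C = l @ x # C'" "src x = u" "walk u l u" "loopy (tgt x) (a @ b) C' v" by auto
  then obtain A B z where "C' = A @ B" "loopy (tgt x) a A z" "loopy z b B v" using Cons.IH by blast
  with C show ?case
    by - (rule exI[of _ "l @ x # A"], rule exI[of _ B],
          rule exI[of _ z], auto intro: loopy_ConsI simp del: loopy.simps(2))
qed

lemma loopy_splitE:
  assumes "loopy u (a @ b) C v" "walk u a z"
  obtains A B where "C = A @ B" "loopy u a A z" "loopy z b B v"
  using loopy_split[OF assms(1)] assms(2) loopy_skeleton_walk walk_end_unique by metis

text \<open>Every cut of the long walk falls into an inserted closed walk, possibly an empty one,
  and so singles out a vertex \<open>p\<close> of the skeleton.\<close>

lemma loopy_cut:
  assumes "loopy u xs (Y1 @ Y2) v"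
  shows "\<exists>a b p A l1 l2 B. xs = a @ b \<and> Y1 = A @ l1 \<and> Y2 = l2 @ B \<and> loopy u a A p \<and>
     walk p (l1 @ l2) p \<and> loopy p b B v"
  using assms
proof (induction xs arbitrary: u Y1)
  case Nil
  then show ?case
    by - (rule exI[of _ "[]"], rule exI[of _ "[]"], rule exI[of _ u], rule exI[of _ "[]"],
          rule exI[of _ Y1], rule exI[of _ Y2], rule exI[of _ "[]"], auto)
next
  case (Cons x xs)
  note IH = Cons.IH
  from Cons.prems obtain l ys where l: "Y1 @ Y2 = l @ x # ys" "src x = u" "walk u l u" "loopy (tgt x) xs ys v" by auto
  from l(1) obtain us where "Y1 @ us = l \<and> Y2 = us @ x # ys \<or> Y1 = l @ us \<and> us @ Y2 = x # ys"
    by (auto simp: append_eq_append_conv2)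
  then show ?case
  proof
    assume "Y1 @ us = l \<and> Y2 = us @ x # ys"
    then show ?thesis using l
      by - (rule exI[of _ "[]"], rule exI[of _ "x # xs"], rule exI[of _ u], rule exI[of _ "[]"],
            rule exI[of _ Y1], rule exI[of _ us],
            rule exI[of _ "x # ys"], auto intro: loopy_ConsI0 simp del: loopy.simps(2))
  next
    assume u: "Y1 = l @ us \<and> us @ Y2 = x # ys"
    show ?thesis
    proof (cases us)
      case Nil
      then show ?thesis using l u
        by - (rule exI[of _ "[]"], rule exI[of _ "x # xs"], rule exI[of _ u], rule exI[of _ "[]"],
              rule exI[of _ Y1], rule exI[of _ "[]"],
              rule exI[of _ "x # ys"], auto intro: loopy_ConsI0 simp del: loopy.simps(2))
    next
      case (Cons x' us')
      then have "x' = x" "ys = us' @ Y2" using u by auto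
      then obtain a b p A l1 l2 B where *: "xs = a @ b" "us' = A @ l1" "Y2 = l2 @ B" "loopy (tgt x) a A p"
        "walk p (l1 @ l2) p" "loopy p b B v" using IH[of "tgt x" us'] l(4) by auto
      then show ?thesis using l u Cons \<open>x' = x\<close>
        by - (rule exI[of _ "x # a"], rule exI[of _ b], rule exI[of _ p],
              rule exI[of _ "l @ x # A"], rule exI[of _ l1], rule exI[of _ l2],
              rule exI[of _ B], auto intro: loopy_ConsI simp del: loopy.simps(2))
    qed
  qed
qed

lemma loopy_occurrence:
  assumes "loopy u xs (Y1 @ x # Y2) v" "x \<notin> set xs"
  shows "\<exists>a b p A l1 l2 B. xs = a @ b \<and> Y1 = A @ l1 \<and> Y2 = l2 @ B \<and> loopy u a A p \<and>
     walk p (l1 @ x # l2) p \<and> loopy p b B v"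
  using assms
proof (induction xs arbitrary: u Y1)
  case Nil
  then show ?case
    by - (rule exI[of _ "[]"], rule exI[of _ "[]"], rule exI[of _ u], rule exI[of _ "[]"],
          rule exI[of _ Y1], rule exI[of _ Y2], rule exI[of _ "[]"], auto)
next
  case (Cons y xs)
  then obtain l ys where l: "Y1 @ x # Y2 = l @ y # ys" "src y = u" "walk u l u" "loopy (tgt y) xs ys v" by auto
  from l(1) obtain us where "Y1 @ us = l \<and> x # Y2 = us @ y # ys \<or> Y1 = l @ us \<and> us @ x # Y2 = y # ys"
    by (auto simp: append_eq_append_conv2)
  then show ?case
  proof
    assume u: "Y1 @ us = l \<and> x # Y2 = us @ y # ys"
    then obtain us' where "us = x # us'" using Cons.prems(2) by (cases us) auto
    then show ?thesis using l u
      by - (rule exI[of _ "[]"], rule exI[of _ "y # xs"], rule exI[of _ u], rule exI[of _ "[]"],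
            rule exI[of _ Y1], rule exI[of _ us'],
            rule exI[of _ "y # ys"], auto intro: loopy_ConsI0 simp del: loopy.simps(2))
  next
    assume u: "Y1 = l @ us \<and> us @ x # Y2 = y # ys"
    then obtain us' where us: "us = y # us'" "ys = us' @ x # Y2" using Cons.prems(2) by (cases us) auto
    then obtain a b p A l1 l2 B where *: "xs = a @ b" "us' = A @ l1" "Y2 = l2 @ B" "loopy (tgt y) a A p"
      "walk p (l1 @ x # l2) p" "loopy p b B v" using Cons.IH[of "tgt y" us'] l(4) Cons.prems(2) by auto
    then show ?thesis using l u us
      by - (rule exI[of _ "y # a"], rule exI[of _ b], rule exI[of _ p], rule exI[of _ "l @ y # A"],
            rule exI[of _ l1], rule exI[of _ l2],
            rule exI[of _ B], auto intro: loopy_ConsI simp del: loopy.simps(2))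
  qed
qed

text \<open>The first nonempty insertion is chosen, so the part \<open>a\<close> before it is
  unchanged.\<close>

lemma loopy_nontrivial:
  assumes "loopy u xs ys v" "ys \<noteq> xs"
  shows "\<exists>a b p l B. xs = a @ b \<and> ys = a @ l @ B \<and> l \<noteq> [] \<and> walk u a p \<and> walk p l p \<and> loopy p b B v"
  using assms
proof (induction xs arbitrary: u ys)
  case Nil
  then show ?case
    by - (rule exI[of _ "[]"], rule exI[of _ "[]"], rule exI[of _ u], rule exI[of _ ys],
          rule exI[of _ "[]"], auto)
next
  case (Cons x xs)
  then obtain l ys' where l: "ys = l @ x # ys'" "src x = u" "walk u l u" "loopy (tgt x) xs ys' v" by auto
  show ?case
  proof (cases "l = []")
    case False
    then show ?thesis using l
      by - (rule exI[of _ "[]"], rule exI[of _ "x # xs"], rule exI[of _ u], rule exI[of _ l],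
            rule exI[of _ "x # ys'"], auto intro: loopy_ConsI0 simp del: loopy.simps(2))
  next
    case True
    then have "ys' \<noteq> xs" using Cons.prems(2) l(1) by simp
    from Cons.IH[OF l(4) this] obtain a b p l' B where "xs = a @ b" "ys' = a @ l' @ B" "l' \<noteq> []" "walk (tgt x) a p" "walk p l' p" "loopy p b B v"
      by blast
    then show ?thesis using l True
      by - (rule exI[of _ "x # a"], rule exI[of _ b], rule exI[of _ p], rule exI[of _ l'],
            rule exI[of _ B], auto intro: loopy_ConsI0 simp del: loopy.simps(2))
  qed
qed

section \<open>Doubling a covered cycle\<close>

text \<open>The two copies are built arrow by arrow along prefixes \<open>d\<close> of
  \<open>c\<close>: \<open>E\<close> and \<open>D\<close> are the copies so far, \<open>c2\<close>
  is the unread part of \<open>c\<close>, and \<open>g\<close> completes the closed walk.\<close>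

lemma covered_cycle_doubles:
  assumes c: "walk v c v" and b: "walk v b v" and dist: "distinct c" and cov: "set c \<subseteq> set b"
  shows "\<exists>E W. eqv (c @ b) (E @ W) \<and> loopy v c E v \<and> loopy v c W v"
proof -
  have "\<exists>q E D g. eqv (c @ b) (E @ c2 @ D @ g) \<and> loopy v d E q \<and> loopy v d D q \<and> walk q c2 v \<and> walk q g v"
    if "c = d @ c2" for d c2
    using that
  proof (induction d arbitrary: c2 rule: rev_induct)
    case Nil
    then show ?case using c b
      by - (rule exI[of _ v], rule exI[of _ "[]"], rule exI[of _ "[]"],
            rule exI[of _ b], auto intro: eqv_refl walk_appI)
  next
    case (snoc x d)
    then obtain q E D g where IH: "eqv (c @ b) (E @ (x # c2) @ D @ g)" "loopy v d E q" "loopy v d D q"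
      "walk q (x # c2) v" "walk q g v" by fastforce
    have q: "src x = q" and c2: "walk (tgt x) c2 v" using IH(4) by auto
    have lx: "loopy q [x] [x] (tgt x)" using q by (intro loopy_refl) simp
    have xd: "x \<notin> set d" "x \<notin> set c2" using dist snoc.prems by auto
    have "x \<in># mset b" using cov snoc.prems by auto
    \<comment> \<open>Apart from the unread part \<open>x # c2\<close>, the arrows present are those
      of \<open>d\<close> and \<open>b\<close>, so a spare \<open>x\<close> occurs in
      \<open>g\<close>, \<open>D\<close> or \<open>E\<close>.\<close>
    have "mset c + mset b = mset E + mset (x # c2) + mset D + mset g"
      using eqv_mset[OF IH(1)] by (simp add: ac_simps)
    moreover have "mset c = mset d + {#x#} + mset c2" using snoc.prems by simp
    ultimately have "mset d + mset b = mset E + mset D + mset g" by (simp add: ac_simps)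
    then have "x \<in># mset E + mset D + mset g" using \<open>x \<in># mset b\<close> by (metis union_iff)
    then consider "x \<in> set g" | "x \<in> set D" | "x \<in> set E" by auto
    then show ?case
    proof cases
      case 1
      then obtain g1 g2 where g: "g = g1 @ x # g2" by (meson split_list)
      then have w: "walk q g1 q" "walk (tgt x) g2 v" using IH(5) q by (auto simp: walk_append)
      have "loopy v (d @ [x]) (E @ [x]) (tgt x)" "loopy v (d @ [x]) (D @ g1 @ [x]) (tgt x)"
        using loopy_append[OF IH(2) lx] loopy_join[OF IH(3) w(1) lx] by auto
      moreover have "eqv (c @ b) ((E @ [x]) @ c2 @ (D @ g1 @ [x]) @ g2)" using IH(1) g by simp
      ultimately show ?thesis using c2 w by blast
    next
      \<comment> \<open>The spare \<open>x\<close> lies in a closed walk inserted into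
        \<open>D\<close> at \<open>p\<close>. Exchanging the parts of \<open>E\<close> and
        \<open>D\<close> beyond \<open>p\<close> gives the copies \<open>E1 @ D2\<close> and
        \<open>D1 @ E2\<close> of \<open>d\<close>, each now followed by an
        \<open>x\<close>.\<close>
      case 2
      then obtain Y1 Y2 where "D = Y1 @ x # Y2" by (meson split_list)
      then obtain a b' p D1 l1 l2 D2 where D: "d = a @ b'" "D = D1 @ l1 @ x # l2 @ D2" "loopy v a D1 p"
        "walk p (l1 @ x # l2) p" "loopy p b' D2 q"
        using loopy_occurrence[of v d Y1 x Y2 q] IH(3) xd by auto
      have l: "walk p l1 q" "walk q (x # l2) p" "walk (tgt x) l2 p" using D(4) q by (auto simp: walk_append)
      obtain E1 E2 where E: "E = E1 @ E2" "loopy v a E1 p" "loopy p b' E2 q"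
        using loopy_splitE IH(2) D(1,3) loopy_skeleton_walk by metis
      define X Y where XY: "X = x # c2" "Y = x # l2"
      have wX: "walk q X v" and wY: "walk q Y p" using IH(4) l(2) XY by auto
      note ww = loopy_walk[OF E(2)] loopy_walk[OF E(3)] loopy_walk[OF D(3)] loopy_walk[OF D(5)]
      have "eqv (c @ b) (E1 @ E2 @ X @ D1 @ l1 @ Y @ D2 @ g)" using IH(1) E D XY by simp
      also have "eqv \<dots> (E2 @ (X @ D1) @ l1 @ Y @ D2 @ g @ E1)"
        using eqv_rot2[of v E1 p "E2 @ X @ D1 @ l1 @ Y @ D2 @ g"] ww wX wY l(1) IH(5)
        by (simp add: walk_appI)
      also have "eqv \<dots> ((X @ D1) @ E2 @ Y @ l1 @ (g @ E1) @ D2)"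
        using eqv_rebase3[OF ww(2) walk_appI[OF wX ww(3)] l(1) wY ww(4) walk_appI[OF IH(5) ww(1)]] by simp
      also have "eqv \<dots> ((E1 @ D2) @ X @ (D1 @ E2) @ Y @ l1 @ g)"
        using eqv_rot2[of q "X @ D1 @ E2 @ Y @ l1 @ g" v "E1 @ D2"] ww wX wY l(1) IH(5)
        by (simp add: walk_appI)
      finally have "eqv (c @ b) (((E1 @ D2) @ [x]) @ c2 @ ((D1 @ E2) @ [x]) @ (l2 @ l1 @ g))" using XY by simp
      moreover have "loopy v (d @ [x]) ((E1 @ D2) @ [x]) (tgt x)" "loopy v (d @ [x]) ((D1 @ E2) @ [x]) (tgt x)"
        using loopy_append[OF loopy_append[OF E(2) D(5)] lx] loopy_append[OF loopy_append[OF D(3) E(3)] lx] D(1)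
        by auto
      moreover have "walk (tgt x) (l2 @ l1 @ g) v" using l IH(5) by (auto intro: walk_appI)
      ultimately show ?thesis using c2 by blast
    next
      case 3
      then obtain Y1 Y2 where "E = Y1 @ x # Y2" by (meson split_list)
      then obtain a b' p E1 l1 l2 E2 where E: "d = a @ b'" "E = E1 @ l1 @ x # l2 @ E2" "loopy v a E1 p"
        "walk p (l1 @ x # l2) p" "loopy p b' E2 q"
        using loopy_occurrence[of v d Y1 x Y2 q] IH(2) xd by auto
      have l: "walk p l1 q" "walk q (x # l2) p" "walk (tgt x) l2 p" using E(4) q by (auto simp: walk_append)
      obtain D1 D2 where D: "D = D1 @ D2" "loopy v a D1 p" "loopy p b' D2 q"
        using loopy_splitE IH(3) E(1,3) loopy_skeleton_walk by metis
      define X Y where XY: "X = x # c2" "Y = x # l2"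
      have wX: "walk q X v" and wY: "walk q Y p" using IH(4) l(2) XY by auto
      note ww = loopy_walk[OF E(3)] loopy_walk[OF E(5)] loopy_walk[OF D(2)] loopy_walk[OF D(3)]
      have "eqv (c @ b) (E1 @ l1 @ Y @ E2 @ X @ D1 @ D2 @ g)" using IH(1) E D XY by simp
      also have "eqv \<dots> (l1 @ Y @ E2 @ (X @ D1) @ D2 @ g @ E1)"
        using eqv_rot2[of v E1 p "l1 @ Y @ E2 @ X @ D1 @ D2 @ g"] ww wX wY l(1) IH(5)
        by (simp add: walk_appI)
      also have "eqv \<dots> (Y @ l1 @ (X @ D1) @ E2 @ (g @ E1) @ D2)"
        using eqv_rebase3[OF l(1) wY ww(2) walk_appI[OF wX ww(3)] ww(4) walk_appI[OF IH(5) ww(1)]] by simp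
      \<comment> \<open>One extra swap at \<open>q\<close> restores the order reached when
        \<open>x\<close> lies in \<open>D\<close>.\<close>
      also have "eqv \<dots> ((X @ D1) @ E2 @ Y @ l1 @ (g @ E1) @ D2)"
        using eqv_swap[of q "Y @ l1" "X @ D1 @ E2" "g @ E1 @ D2"] ww wX wY l(1) IH(5)
        by (simp add: walk_appI)
      also have "eqv \<dots> ((E1 @ D2) @ X @ (D1 @ E2) @ Y @ l1 @ g)"
        using eqv_rot2[of q "X @ D1 @ E2 @ Y @ l1 @ g" v "E1 @ D2"] ww wX wY l(1) IH(5)
        by (simp add: walk_appI)
      finally have "eqv (c @ b) (((E1 @ D2) @ [x]) @ c2 @ ((D1 @ E2) @ [x]) @ (l2 @ l1 @ g))" using XY by simp
      moreover have "loopy v (d @ [x]) ((E1 @ D2) @ [x]) (tgt x)" "loopy v (d @ [x]) ((D1 @ E2) @ [x]) (tgt x)"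
        using loopy_append[OF loopy_append[OF E(3) D(3)] lx] loopy_append[OF loopy_append[OF D(2) E(5)] lx] E(1)
        by auto
      moreover have "walk (tgt x) (l2 @ l1 @ g) v" using l IH(5) by (auto intro: walk_appI)
      ultimately show ?thesis using c2 by blast
    qed
  qed
  from this[of c "[]"] obtain E D g where *: "eqv (c @ b) (E @ D @ g)" "loopy v c E v" "loopy v c D v" "walk v g v"
    by auto
  have "loopy v c (D @ g) v" using loopy_append[OF *(3), of "[]" g v] *(4) by simp
  with * show ?thesis by blast
qed

subsection \<open>Pairs of copies of a cycle\<close>

text \<open>\<open>R\<close> is the part outside the two decorated copies of \<open>w\<close>. Its
  length is the quantity that the next lemmas increase.\<close>

definition doubled :: "'a list \<Rightarrow> 'v \<Rightarrow> 'a list \<Rightarrow> 'a list \<Rightarrow> 'a list \<Rightarrow> 'a list \<Rightarrow> bool" where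
  "doubled h u w R E W \<longleftrightarrow>
     w \<noteq> [] \<and> eqv h (R @ E @ W) \<and> walk u R u \<and> loopy u w E u \<and> loopy u w W u"

lemma doubled_commute:
  assumes "doubled h u w R E W"
  shows "doubled h u w R W E"
proof -
  have "eqv (R @ E @ W) (R @ W @ E)"
    using eqv_swap_mid[of u R u E W "[]"] assms loopy_walk unfolding doubled_def by auto
  then show ?thesis using assms eqv_trans unfolding doubled_def by blast
qed

text \<open>An insertion that passes through the base \<open>u\<close> can be started at
  \<open>u\<close> and then joined to \<open>R\<close>. The two copies exchange their parts beyond
  \<open>p\<close> on the way.\<close>

lemma doubled_grow_base:
  assumes d: "doubled h u w R (S @ l1 @ l2 @ Q) W" and w: "w = s @ q"
    and S: "loopy u s S p" and Q: "loopy p q Q u" and l: "walk p l1 u" "walk u l2 p"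
  shows "\<exists>E' W'. doubled h u w (R @ l2 @ l1) E' W'"
proof -
  have R: "walk u R u" and e: "eqv h (R @ S @ l1 @ l2 @ Q @ W)"
    using d unfolding doubled_def by auto
  have "loopy u (s @ q) W u" using d w unfolding doubled_def by auto
  then obtain S' Q' where W: "W = S' @ Q'" "loopy u s S' p" "loopy p q Q' u"
    using loopy_splitE loopy_skeleton_walk[OF S] by metis
  note ww = loopy_walk[OF S] loopy_walk[OF Q] loopy_walk[OF W(2)] loopy_walk[OF W(3)]
  note e
  also have "eqv (R @ S @ l1 @ l2 @ Q @ W) (l1 @ l2 @ Q @ S' @ Q' @ R @ S)"
    using eqv_rot2[of u "R @ S" p "l1 @ l2 @ Q @ S' @ Q'"] ww R l W by (simp add: walk_appI)
  also have "eqv \<dots> (l2 @ l1 @ S' @ Q @ R @ S @ Q')"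
    using eqv_rebase3[OF l ww(2,3,4) walk_appI[OF R ww(1)]] by simp
  also have "eqv \<dots> (R @ S @ Q' @ l2 @ l1 @ S' @ Q)"
    using eqv_rot2[of u "l2 @ l1 @ S' @ Q" u "R @ S @ Q'"] ww R l by (simp add: walk_appI)
  also have "eqv \<dots> (R @ l2 @ l1 @ S @ Q' @ S' @ Q)"
    using eqv_swap_mid[of u R u "S @ Q'" "l2 @ l1" "S' @ Q"] ww R l by (simp add: walk_appI)
  finally have "doubled h u w (R @ l2 @ l1) (S @ Q') (S' @ Q)"
    unfolding doubled_def using R l w d loopy_append[OF S W(3)] loopy_append[OF W(2) Q]
    by (auto simp: walk_appI doubled_def)
  then show ?thesis by blast
qed

text \<open>A closed factor at \<open>z\<close> is carried by one swap to a visit of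
  \<open>z\<close> in \<open>R\<close>.\<close>

lemma doubled_grow_factor:
  assumes d: "doubled h u w (R1 @ R2) (S @ \<alpha> @ g @ \<beta> @ Q) W" and w: "w = s @ q"
    and S: "loopy u s S p" and Q: "loopy p q Q u"
    and l: "walk p \<alpha> z" "walk z g z" "walk z \<beta> p" and R: "walk u R1 z" "walk z R2 u"
  shows "doubled h u w (R1 @ g @ R2) (S @ \<alpha> @ \<beta> @ Q) W"
proof -
  have e: "eqv h (R1 @ R2 @ S @ \<alpha> @ g @ \<beta> @ Q @ W)" and W: "walk u W u"
    using d loopy_walk unfolding doubled_def by auto
  note ww = loopy_walk[OF S] loopy_walk[OF Q]
  note e
  also have "eqv (R1 @ R2 @ S @ \<alpha> @ g @ \<beta> @ Q @ W) (R1 @ g @ R2 @ S @ \<alpha> @ \<beta> @ Q @ W)"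
    using eqv_swap_mid[of u R1 z "R2 @ S @ \<alpha>" g "\<beta> @ Q @ W"] ww W l R by (simp add: walk_appI)
  finally show ?thesis
    unfolding doubled_def using d R l w loopy_join[OF S walk_appI[OF l(1,3)] Q]
    by (auto simp: walk_appI doubled_def)
qed

text \<open>\<open>R\<close> and both copies visit \<open>z\<close>, so all three can be rebased
  there. Recombining the copies leaves a new rest that contains the arrows of \<open>R\<close> and
  of \<open>m1 @ m2\<close>, at a new base on \<open>w\<close>.\<close>

lemma doubled_grow_merge:
  assumes d: "doubled h u w (R1 @ R2) (E1 @ E2) (A' @ m1 @ m2 @ B')" and w: "w = a' @ b'"
    and A': "loopy u a' A' p'" and B': "loopy p' b' B' u"
    and m: "walk p' m1 z" "walk z m2 p'" and R: "walk u R1 z" "walk z R2 u" and E1: "walk u E1 z"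
  shows "\<exists>u' w' R' E' W'. doubled h u' w' R' E' W' \<and> length (R1 @ R2) + length (m1 @ m2) \<le> length R'"
proof -
  have wne: "w \<noteq> []" and e: "eqv h (R1 @ R2 @ E1 @ E2 @ A' @ m1 @ m2 @ B')" and le: "loopy u w (E1 @ E2) u"
    using d unfolding doubled_def by auto
  obtain a b p A l1 l2 B where E: "w = a @ b" "E1 = A @ l1" "E2 = l2 @ B" "loopy u a A p"
     "walk p (l1 @ l2) p" "loopy p b B u" using loopy_cut[OF le] by blast
  have l1: "walk p l1 z" using E1 E loopy_walk walk_append_drop by blast
  then have l2: "walk z l2 p" using E(5) walk_append_drop by blast
  \<comment> \<open>The visit of \<open>z\<close> in the first copy hangs at \<open>p\<close>, that
    in the second at \<open>p'\<close>. Their order along \<open>w\<close> decides how the copies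
    are recombined and which of the two becomes the base.\<close>
  from w E(1) obtain k where "a' = a @ k \<and> b = k @ b' \<or> a = a' @ k \<and> b' = k @ b"
    by (auto simp: append_eq_append_conv2)
  then show ?thesis
  proof
    assume k: "a' = a @ k \<and> b = k @ b'"
    then obtain A2 K where A2: "A' = A2 @ K" "loopy u a A2 p" "loopy p k K p'"
      using loopy_splitE A' loopy_skeleton_walk[OF E(4)] by metis
    then obtain K' D where D: "B = K' @ D" "loopy p k K' p'" "loopy p' b' D u"
      using loopy_splitE E(6) k loopy_skeleton_walk[OF A2(3)] by metis
    note ww = loopy_walk[OF E(4)] loopy_walk[OF A2(2)] loopy_walk[OF A2(3)] loopy_walk[OF D(2)]
      loopy_walk[OF D(3)] loopy_walk[OF B'] l1 l2 m R
    note e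
    also have "eqv (R1 @ R2 @ E1 @ E2 @ A' @ m1 @ m2 @ B')
        (R2 @ (A @ l1) @ (l2 @ K' @ D) @ (A2 @ K @ m1) @ (m2 @ B') @ R1)"
      using eqv_rot2[of u R1 z "R2 @ A @ l1 @ l2 @ K' @ D @ A2 @ K @ m1 @ m2 @ B'"] ww E A2 D
      by (simp add: walk_appI)
    also have "eqv \<dots> ((A @ l1) @ R2 @ (A2 @ K @ m1) @ (l2 @ K' @ D) @ R1 @ (m2 @ B'))"
      using ww by (intro eqv_rebase3[of z _ u]) (auto intro: walk_appI)
    also have "eqv \<dots> (A @ K @ m1 @ l2 @ l1 @ R2 @ A2 @ K' @ D @ R1 @ m2 @ B')"
      using eqv_swap_mid[of u A p "l1 @ R2 @ A2" "K @ m1 @ l2" "K' @ D @ R1 @ m2 @ B'"] ww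
      by (simp add: walk_appI)
    also have "eqv \<dots> (A @ K @ m1 @ l2 @ l1 @ R2 @ R1 @ m2 @ B' @ A2 @ K' @ D)"
      using eqv_swap_mid[of u "A @ K @ m1 @ l2 @ l1 @ R2" u "A2 @ K' @ D" "R1 @ m2 @ B'" "[]"] ww
      by (simp add: walk_appI)
    also have "eqv \<dots> ((m1 @ l2 @ l1 @ R2 @ R1 @ m2) @ (B' @ A2 @ K') @ D @ A @ K)"
      using eqv_rot2[of u "A @ K" p' "m1 @ l2 @ l1 @ R2 @ R1 @ m2 @ B' @ A2 @ K' @ D"] ww
      by (simp add: walk_appI)
    finally have "doubled h p' (b' @ a @ k) (m1 @ l2 @ l1 @ R2 @ R1 @ m2) (B' @ A2 @ K') (D @ A @ K)"
      unfolding doubled_def using wne w k ww loopy_append[OF B' loopy_append[OF A2(2) D(2)]]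
       loopy_append[OF D(3) loopy_append[OF E(4) A2(3)]]
      by (auto simp: walk_appI)
    then show ?thesis by fastforce
  next
    assume k: "a = a' @ k \<and> b' = k @ b"
    then obtain A2 K where A2: "A = A2 @ K" "loopy u a' A2 p'" "loopy p' k K p"
      using loopy_splitE E(4) loopy_skeleton_walk[OF A'] by metis
    then obtain K' D where D: "B' = K' @ D" "loopy p' k K' p" "loopy p b D u"
      using loopy_splitE B' k loopy_skeleton_walk[OF A2(3)] by metis
    note ww = loopy_walk[OF A'] loopy_walk[OF A2(2)] loopy_walk[OF A2(3)] loopy_walk[OF D(2)]
      loopy_walk[OF D(3)] loopy_walk[OF E(6)] l1 l2 m R
    note e
    also have "eqv (R1 @ R2 @ E1 @ E2 @ A' @ m1 @ m2 @ B')
        (R2 @ (A2 @ K @ l1) @ (l2 @ B) @ (A' @ m1) @ (m2 @ K' @ D) @ R1)"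
      using eqv_rot2[of u R1 z "R2 @ A2 @ K @ l1 @ l2 @ B @ A' @ m1 @ m2 @ K' @ D"] ww E A2 D
      by (simp add: walk_appI)
    also have "eqv \<dots> ((A2 @ K @ l1) @ R2 @ (A' @ m1) @ (l2 @ B) @ R1 @ (m2 @ K' @ D))"
      using ww by (intro eqv_rebase3[of z _ u]) (auto intro: walk_appI)
    also have "eqv \<dots> (A' @ m1 @ l2 @ B @ A2 @ K @ l1 @ R2 @ R1 @ m2 @ K' @ D)"
      using eqv_swap[of u "A2 @ K @ l1 @ R2" "A' @ m1 @ l2 @ B" "R1 @ m2 @ K' @ D"] ww
      by (simp add: walk_appI)
    also have "eqv \<dots> (A' @ K @ l1 @ R2 @ R1 @ m2 @ m1 @ l2 @ B @ A2 @ K' @ D)"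
      using eqv_swap_mid[of u A' p' "m1 @ l2 @ B @ A2" "K @ l1 @ R2 @ R1 @ m2" "K' @ D"] ww
      by (simp add: walk_appI)
    also have "eqv \<dots> ((l1 @ R2 @ R1 @ m2 @ m1 @ l2) @ (B @ A2 @ K') @ D @ A' @ K)"
      using eqv_rot2[of u "A' @ K" p "l1 @ R2 @ R1 @ m2 @ m1 @ l2 @ B @ A2 @ K' @ D"] ww
      by (simp add: walk_appI)
    finally have "doubled h p (b @ a' @ k) (l1 @ R2 @ R1 @ m2 @ m1 @ l2) (B @ A2 @ K') (D @ A' @ K)"
      unfolding doubled_def using wne E(1) k ww loopy_append[OF E(6) loopy_append[OF A2(2) D(2)]]
       loopy_append[OF D(3) loopy_append[OF A' A2(3)]]
      by (auto simp: walk_appI)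
    then show ?thesis by fastforce
  qed
qed

subsection \<open>Primitive cycles with a private arrow\<close>

text \<open>As \<open>u\<close> is not on \<open>c\<close>, the place where \<open>R\<close> sits is
  inside a nonempty insertion. That insertion together with \<open>R\<close> is the new, longer
  rest.\<close>

lemma doubled_rebase_insert:
  assumes X: "loopy t c (X1 @ X2) t" and Y: "loopy t c Y t" and x: "walk t X1 u" "walk u X2 t"
    and R: "walk u R u" and e: "eqv h (X1 @ R @ X2 @ Y)" and c: "c \<noteq> []" "u \<notin> src ` set c"
  shows "\<exists>p w' R' E' W'. doubled h p w' R' E' W' \<and> length R < length R'"
proof -
  obtain a b p A l1 l2 B where X': "c = a @ b" "X1 = A @ l1" "X2 = l2 @ B" "loopy t a A p"
    "walk p (l1 @ l2) p" "loopy p b B t"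
    using loopy_cut[OF X] by blast
  have l1: "walk p l1 u" using X' x(1) loopy_walk walk_append_drop by blast
  then have l2: "walk u l2 p" using X'(5) walk_append_drop by blast
  have "l1 @ l2 \<noteq> []"
  proof
    assume "l1 @ l2 = []"
    then have "p = u" using l1 by simp
    then show False
      using cut_in_srcs[of t a u b] loopy_skeleton_walk X'(1,4,6) c by metis
  qed
  then have len: "length R < length (l1 @ R @ l2)" by auto
  obtain A2 B2 where Y': "Y = A2 @ B2" "loopy t a A2 p" "loopy p b B2 t"
    using loopy_splitE Y X'(1) loopy_skeleton_walk[OF X'(4)] by metis
  note ww = loopy_walk[OF X'(4)] loopy_walk[OF X'(6)] loopy_walk[OF Y'(2)] loopy_walk[OF Y'(3)] l1 l2 R
  note e
  also have "eqv (X1 @ R @ X2 @ Y) ((l1 @ R @ l2) @ (B @ A2) @ B2 @ A)"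
    using eqv_rot2[of t A p "l1 @ R @ l2 @ B @ A2 @ B2"] ww X' Y' by (simp add: walk_appI)
  finally have "doubled h p (b @ a) (l1 @ R @ l2) (B @ A2) (B2 @ A)"
    unfolding doubled_def
    using c(1) X'(1) ww loopy_append[OF X'(6) Y'(2)] loopy_append[OF Y'(3) X'(4)] by (auto simp: walk_appI)
  with len show ?thesis by blast
qed

text \<open>\<open>R\<close> cannot outgrow \<open>h\<close>, so a longer rest can be assumed
  impossible. An insertion in either copy would yield one; without insertions \<open>w @ w\<close>
  is a square.\<close>

lemma not_doubled:
  assumes nz: "\<not> zero h"
    and cover: "\<And>c b v. eqv h (c @ b) \<Longrightarrow> c \<noteq> [] \<Longrightarrow> walk v c v \<Longrightarrow> walk v b v \<Longrightarrow>
      distinct (map src c) \<Longrightarrow> set c \<subseteq> set b"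
  shows "\<not> doubled h u w R E W"
proof (induction "length h - length R" arbitrary: u w R E W rule: less_induct)
  case less
  have grow: False if "doubled h u' w' R' E' W'" "length R < length R'" for u' w' R' E' W'
  proof -
    have "length R' \<le> length h" using that(1) eqv_length unfolding doubled_def by fastforce
    then show False using less that by (meson diff_less_mono2 order_less_le_trans)
  qed
  have key: False if d: "doubled h u w R E W" and ne: "E \<noteq> w" for E W
  proof -
    have R: "walk u R u" and W: "loopy u w W u" and e: "eqv h (R @ E @ W)"
      using d unfolding doubled_def by auto
    have "loopy u w E u" using d unfolding doubled_def by auto
    from loopy_nontrivial[OF this ne] obtain s q p l Q where
      E: "w = s @ q" "E = s @ l @ Q" "l \<noteq> []" "walk u s p" "walk p l p" "loopy p q Q u" by blast
    note S = loopy_refl[OF E(4)]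
    note Q = loopy_walk[OF E(6)] and Ww = loopy_walk[OF W]
    obtain \<alpha> c \<beta> t where l: "l = \<alpha> @ c @ \<beta>" "walk p \<alpha> t" "walk t c t" "walk t \<beta> p" "c \<noteq> []"
      "distinct (map src c)" using primitive_factor[OF E(5,3)] by blast
    \<comment> \<open>The next three facts translate the growth lemmas into restrictions on the
      insertion \<open>l\<close>.\<close>
    have no_factor: "z \<notin> src ` set R"
      if g: "l = \<alpha>' @ g @ \<beta>'" "walk p \<alpha>' z" "walk z g z" "walk z \<beta>' p" "g \<noteq> []" for \<alpha>' g \<beta>' z
    proof
      assume "z \<in> src ` set R"
      then obtain R1 R2 where R12: "R = R1 @ R2" "walk u R1 z" "walk z R2 u"
        using walk_cut[OF R] by blast
      have "doubled h u w (R1 @ R2) (s @ \<alpha>' @ g @ \<beta>' @ Q) W" using d E(2) g(1) R12(1) by simp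
      from doubled_grow_factor[OF this E(1) S E(6) g(2-4) R12(2,3)] show False
        using grow R12(1) g(5) by fastforce
    qed
    have no_base: False if "l = l1 @ l2" "walk p l1 u" "walk u l2 p" for l1 l2
    proof -
      have "doubled h u w R (s @ l1 @ l2 @ Q) W" using d E(2) that(1) by simp
      from doubled_grow_base[OF this E(1) S E(6) that(2,3)] show False
        using grow that(1) E(3) by fastforce
    qed
    have merge: False
      if m: "l = l1 @ l2" "walk p l1 z" "walk z l2 p" "z \<in> src ` set R" "f \<in> set (W @ s @ Q)" "tgt f = z"
      for l1 l2 z f
    proof -
      obtain R1 R2 where R12: "R = R1 @ R2" "walk u R1 z" "walk z R2 u"
        using walk_cut[OF R m(4)] by blast
      consider "f \<in> set W" | "f \<in> set (s @ Q)" using m(5) by auto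
      then show False
      proof cases
        case 1
        then obtain W1 W2 where W12: "W = (W1 @ [f]) @ W2" by (metis append_Cons append_Nil append_assoc split_list)
        then have W1: "walk u (W1 @ [f]) z" using Ww m(6) by (auto simp: walk_append)
        have "doubled h u w (R1 @ R2) ((W1 @ [f]) @ W2) (s @ l1 @ l2 @ Q)"
          using doubled_commute[OF d] E(2) m(1) R12(1) W12 by simp
        from doubled_grow_merge[OF this E(1) S E(6) m(2,3) R12(2,3) W1]
        obtain u' w' R' E' W' where R': "doubled h u' w' R' E' W'"
          "length (R1 @ R2) + length (l1 @ l2) \<le> length R'" by blast
        have "0 < length (l1 @ l2)" using m(1) E(3) by simp
        then have "length R < length R'" using R'(2) unfolding R12(1) by linarith
        then show False using grow[OF R'(1)] by blast
      next
        case 2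
        then obtain E1 E2 where E12: "s @ Q = (E1 @ [f]) @ E2"
          by (metis append_Cons append_Nil append_assoc split_list)
        have "walk u (s @ Q) u" using E(4) Q by (rule walk_appI)
        then have E1: "walk u (E1 @ [f]) z" unfolding E12 using m(6) by (auto simp: walk_append)
        obtain S2 Q2 where SQ: "W = S2 @ Q2" "loopy u s S2 p" "loopy p q Q2 u"
          using loopy_splitE W E(1,4) by metis
        \<comment> \<open>The visit of \<open>z\<close> is in the same copy as \<open>l\<close>, so
          \<open>l\<close> is first moved to the other copy, as \<open>doubled_grow_merge\<close>
          requires.\<close>
        note e
        also have "eqv (R @ E @ W) (R @ s @ Q @ S2 @ l @ Q2)"
          using eqv_swap_mid[of u "R @ s" p l "Q @ S2" Q2] R E(2,4,5) Q loopy_walk[OF SQ(2)] loopy_walk[OF SQ(3)] SQ(1)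
          by (simp add: walk_appI)
        finally have "doubled h u w (R1 @ R2) ((E1 @ [f]) @ E2) (S2 @ l1 @ l2 @ Q2)"
          using d loopy_append[OF S E(6)] loopy_join[OF SQ(2) E(5) SQ(3)] E(1) E12 m(1) R12(1)
          unfolding doubled_def by (metis append_assoc)
        from doubled_grow_merge[OF this E(1) SQ(2,3) m(2,3) R12(2,3) E1]
        obtain u' w' R' E' W' where R': "doubled h u' w' R' E' W'"
          "length (R1 @ R2) + length (l1 @ l2) \<le> length R'" by blast
        have "0 < length (l1 @ l2)" using m(1) E(3) by simp
        then have "length R < length R'" using R'(2) unfolding R12(1) by linarith
        then show False using grow[OF R'(1)] by blast
      qed
    qed
    \<comment> \<open>The remainder of \<open>E @ W\<close> once \<open>c\<close> is removed;
      \<open>R\<close> is deliberately left out.\<close>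
    define b where "b = \<beta> @ Q @ W @ s @ \<alpha>"
    have b: "walk t b t" unfolding b_def using l(2,4) E(4) Q Ww by (auto intro: walk_appI)
    have "eqv h (c @ \<beta> @ Q @ W @ R @ s @ \<alpha>)"
    proof -
      note e
      also have "eqv (R @ E @ W) (c @ \<beta> @ Q @ W @ R @ s @ \<alpha>)"
        using eqv_rot2[of u "R @ s @ \<alpha>" t "c @ \<beta> @ Q @ W"] R l E(2,4) Q Ww by (simp add: walk_appI)
      finally show ?thesis .
    qed
    moreover have "walk t (\<beta> @ Q @ W @ R @ s @ \<alpha>) t"
      using l(2,4) E(4) Q Ww R by (simp add: walk_appI)
    ultimately have cov: "set c \<subseteq> set (\<beta> @ Q @ W @ R @ s @ \<alpha>)" using cover l(3,5,6) by blast
    \<comment> \<open>Induction along \<open>c\<close>: an arrow \<open>f\<close> whose source is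
      off \<open>R\<close> is not in \<open>R\<close>, so covering supplies another \<open>f\<close>
      in \<open>b\<close>. If its head were on \<open>R\<close>, this second \<open>f\<close> would
      give a closed factor there or a merge.\<close>
    have avoid: "z \<notin> src ` set R" if "c = c1 @ c2" "walk t c1 z" "c2 \<noteq> []" for c1 c2 z
      using that
    proof (induction c1 arbitrary: c2 z rule: rev_induct)
      case Nil
      then show ?case using no_factor[OF l(1,2,3,4,5)] by simp
    next
      case (snoc f c1)
      have tf: "tgt f = z" "walk t c1 (src f)" using snoc.prems(2) by (auto simp: walk_append)
      have "src f \<notin> src ` set R" using snoc.IH[of "f # c2" "src f"] snoc.prems(1) tf by simp
      moreover have "f \<in> set c" using snoc.prems(1) by simp
      ultimately have f: "f \<in> set (\<beta> @ Q @ W @ s @ \<alpha>)" using cov by auto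
      have w1: "walk p (\<alpha> @ c1 @ [f]) z" using l(2) snoc.prems(2) by (auto intro: walk_appI)
      have c2: "walk z c2 t" using snoc.prems l(3) walk_append_drop by blast
      show ?case
      proof
        assume z: "z \<in> src ` set R"
        consider "f \<in> set \<beta>" | "f \<in> set \<alpha>" | "f \<in> set (W @ s @ Q)" using f by auto
        then show False
        proof cases
          case 1
          then obtain \<beta>1 \<beta>2 where B: "\<beta> = (\<beta>1 @ [f]) @ \<beta>2"
            by (metis append_Cons append_Nil append_assoc split_list)
          then have "walk t (\<beta>1 @ [f]) z" "walk z \<beta>2 p" using l(4) tf(1) by (auto simp: walk_append)
          then show False
            using no_factor[of "\<alpha> @ c1 @ [f]" "c2 @ \<beta>1 @ [f]" \<beta>2 z] l(1) B w1 c2 z snoc.prems(1)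
            by (auto intro: walk_appI)
        next
          case 2
          then obtain \<alpha>1 \<alpha>2 where A: "\<alpha> = (\<alpha>1 @ [f]) @ \<alpha>2"
            by (metis append_Cons append_Nil append_assoc split_list)
          then have "walk p (\<alpha>1 @ [f]) z" "walk z \<alpha>2 t" using l(2) tf(1) by (auto simp: walk_append)
          then show False
            using no_factor[of "\<alpha>1 @ [f]" "\<alpha>2 @ c1 @ [f]" "c2 @ \<beta>" z] l(1,4) A c2 z snoc.prems
            by (auto intro: walk_appI)
        next
          case 3
          then show False
            using merge[of "\<alpha> @ c1 @ [f]" "c2 @ \<beta>" z f] l(1,4) w1 c2 z tf(1) snoc.prems(1)
            by (auto intro: walk_appI)
        qed
      qed
    qed
    have "set c \<subseteq> set b"
    proof
      fix f assume f: "f \<in> set c"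
      then obtain c1 c2 where c: "c = c1 @ f # c2" by (meson split_list)
      then have "walk t c1 (src f)" using l(3) by (auto simp: walk_append)
      then have "src f \<notin> src ` set R" using avoid c by blast
      then show "f \<in> set b" using cov f unfolding b_def by auto
    qed
    then obtain X Y where XY: "eqv (c @ b) (X @ Y)" "loopy t c X t" "loopy t c Y t"
      using covered_cycle_doubles[OF l(3) b l(6)[unfolded distinct_map, THEN conjunct1]] by blast
    have uc: "u \<notin> src ` set c"
    proof
      assume "u \<in> src ` set c"
      then obtain c1 c2 where "c = c1 @ c2" "walk t c1 u" "walk u c2 t" using walk_cut[OF l(3)] by blast
      then show False using no_base[of "\<alpha> @ c1" "c2 @ \<beta>"] l by (auto intro: walk_appI)
    qed
    have EW: "eqv (E @ W) (X @ Y)"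
    proof -
      have "eqv (E @ W) (c @ b)"
        using eqv_rot2[of u "s @ \<alpha>" t "c @ \<beta> @ Q @ W"] l E(2,4) Q Ww unfolding b_def by (simp add: walk_appI)
      then show ?thesis using XY(1) eqv_trans by blast
    qed
    have wEW: "walk u (E @ W) u" using E(2,4,5) Q Ww by (auto intro: walk_appI)
    have ne': "E @ W \<noteq> []" using E(2,3) by simp
    have "u \<in> src ` set (X @ Y)"
      using cut_in_srcs[of u "[]" u "E @ W"] wEW ne' eqv_set[OF EW] by simp
    moreover have "walk t (X @ Y) t" using XY loopy_walk walk_appI by blast
    ultimately obtain \<gamma>1 \<gamma>2 where g: "X @ Y = \<gamma>1 @ \<gamma>2" "walk t \<gamma>1 u" "walk u \<gamma>2 t"
      using walk_cut by metis
    \<comment> \<open>\<open>R\<close> is put back, at a visit of \<open>u\<close>, into the doubled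
      form of \<open>c\<close> obtained for \<open>E @ W\<close>.\<close>
    have "eqv ([] @ R @ E @ W) (\<gamma>1 @ R @ \<gamma>2)"
      using wEW R by (intro eqv_insert[OF EW ne' _ _ _ g]) auto
    then have hg: "eqv h (\<gamma>1 @ R @ \<gamma>2)" using e eqv_trans by (metis append_Nil)
    from g(1) obtain us where "X = \<gamma>1 @ us \<and> us @ Y = \<gamma>2 \<or> X @ us = \<gamma>1 \<and> Y = us @ \<gamma>2"
      by (auto simp: append_eq_append_conv2)
    then show False
    proof
      assume us: "X = \<gamma>1 @ us \<and> us @ Y = \<gamma>2"
      then have "walk u us t" using g(2) XY(2) loopy_walk walk_append_drop by blast
      then show False
        using doubled_rebase_insert[of t c \<gamma>1 us Y u R h] us XY g R hg l(5) uc grow by auto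
    next
      assume us: "X @ us = \<gamma>1 \<and> Y = us @ \<gamma>2"
      then have w: "walk t us u" using g(2) XY(2) loopy_walk walk_append_drop by blast
      have "eqv (\<gamma>1 @ R @ \<gamma>2) (us @ R @ \<gamma>2 @ X)"
        using eqv_rot2[of t X t "us @ R @ \<gamma>2"] us w g R loopy_walk[OF XY(2)] by (auto simp: walk_appI)
      then have "eqv h (us @ R @ \<gamma>2 @ X)" using hg eqv_trans by blast
      then show False
        using doubled_rebase_insert[of t c us \<gamma>2 X u R h] us XY g w R l(5) uc grow by auto
    qed
  qed
  show ?case
  proof
    assume d: "doubled h u w R E W"
    then have "E = w" "W = w" using key doubled_commute by blast+
    then have "eqv h (R @ w @ w @ [])" "walk u R u" "walk u w u" "w \<noteq> []"
      using d loopy_walk unfolding doubled_def by auto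
    then show False using nz zero_square zero_eqv by (metis walk.simps(1))
  qed
qed

text \<open>If every such \<open>c\<close> were covered by its remainder, doubling one of them would
  give a doubled form with empty rest, contradicting \<open>not_doubled\<close>.\<close>

lemma private_primitive_factor:
  assumes h: "walk v h v" "h \<noteq> []" and nz: "\<not> zero h" and np: "\<not> distinct (map src h)"
  shows "\<exists>c b u. eqv h (c @ b) \<and> c \<noteq> [] \<and> walk u c u \<and> walk u b u \<and> distinct (map src c) \<and>
    \<not> set c \<subseteq> set b"
proof (rule ccontr)
  assume "\<not> ?thesis"
  then have cover: "set c \<subseteq> set b"
    if "eqv h (c @ b)" "c \<noteq> []" "walk u c u" "walk u b u" "distinct (map src c)" for c b u
    using that by blast
  obtain \<alpha> c \<beta> t where l: "h = \<alpha> @ c @ \<beta>" "walk v \<alpha> t" "walk t c t" "walk t \<beta> v" "c \<noteq> []"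
      "distinct (map src c)" using primitive_factor[OF h] by blast
  have e: "eqv h (c @ \<beta> @ \<alpha>)" using eqv_rot2[of v \<alpha> t "c @ \<beta>"] l by (simp add: walk_appI)
  have b: "walk t (\<beta> @ \<alpha>) t" using l by (auto intro: walk_appI)
  obtain E W where "eqv (c @ \<beta> @ \<alpha>) (E @ W)" "loopy t c E t" "loopy t c W t"
    using covered_cycle_doubles[OF l(3) b l(6)[unfolded distinct_map, THEN conjunct1] cover[OF e l(5,3) b l(6)]] by blast
  then have "doubled h t c [] E W" using e l(5) eqv_trans unfolding doubled_def by auto
  moreover have "\<not> doubled h t c [] E W" by (rule not_doubled[OF nz]) (rule cover)
  ultimately show False by contradiction
qed

subsection \<open>Splitting off a cycle with zero remainder\<close>

text \<open>Inserting \<open>c\<close> must break the square in \<open>b\<close>. An insertion into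
  \<open>\<eta>\<close> would keep it, so \<open>v\<close> lies on \<open>\<theta>\<close> and
  \<open>c\<close> separates the pieces of one copy.\<close>

lemma zero_remainder:
  assumes c: "walk v c v" and b: "walk v b v" "b \<noteq> []" and nz: "\<not> zero (c @ b)" and z: "zero b"
  shows "\<exists>\<theta>1 \<theta>2 \<eta> u. \<theta>2 @ \<theta>1 \<noteq> [] \<and> walk u \<theta>1 v \<and> walk v \<theta>2 u \<and> walk u \<eta> u \<and>
    eqv (c @ b) (c @ \<theta>2 @ \<theta>1 @ \<theta>2 @ \<eta> @ \<theta>1)"
proof -
  obtain u \<theta> \<eta> where t: "\<theta> \<noteq> []" "walk u \<theta> u" "walk u \<eta> u" "eqv b (\<theta> @ \<theta> @ \<eta>)"
    using z unfolding zero_def by blast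
  have ins: "eqv (c @ b) (\<gamma>1 @ c @ \<gamma>2)" if g: "\<theta> @ \<theta> @ \<eta> = \<gamma>1 @ \<gamma>2" "walk u \<gamma>1 v" "walk v \<gamma>2 u" for \<gamma>1 \<gamma>2
    using eqv_insert[OF t(4) b(2) _ _ b(1) g c, of "[]"] by simp
  have "v \<in> src ` set b" using cut_in_srcs[of v "[]" v b] b by simp
  then consider "v \<in> src ` set \<theta>" | "v \<in> src ` set \<eta>" using eqv_set[OF t(4)] by auto
  then show ?thesis
  proof cases
    case 1
    then obtain \<theta>1 \<theta>2 where \<theta>: "\<theta> = \<theta>1 @ \<theta>2" "walk u \<theta>1 v" "walk v \<theta>2 u" using walk_cut[OF t(2)] by blast
    have "eqv (c @ b) (\<theta>1 @ c @ \<theta>2 @ \<theta>1 @ \<theta>2 @ \<eta>)"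
      using ins[of \<theta>1 "\<theta>2 @ \<theta>1 @ \<theta>2 @ \<eta>"] \<theta> t by (simp add: walk_appI)
    also have "eqv \<dots> (c @ \<theta>2 @ \<theta>1 @ \<theta>2 @ \<eta> @ \<theta>1)"
      using eqv_rot2[of u \<theta>1 v "c @ \<theta>2 @ \<theta>1 @ \<theta>2 @ \<eta>"] \<theta> t c by (simp add: walk_appI)
    finally show ?thesis using \<theta> t by fastforce
  next
    case 2
    then obtain \<eta>1 \<eta>2 where \<eta>: "\<eta> = \<eta>1 @ \<eta>2" "walk u \<eta>1 v" "walk v \<eta>2 u" using walk_cut[OF t(3)] by blast
    have "eqv (c @ b) (\<theta> @ \<theta> @ \<eta>1 @ c @ \<eta>2)"
      using ins[of "\<theta> @ \<theta> @ \<eta>1" \<eta>2] \<eta> t by (simp add: walk_appI)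
    moreover have "walk u (\<eta>1 @ c @ \<eta>2) u" using \<eta> c by (simp add: walk_appI)
    ultimately have "zero (c @ b)" using t unfolding zero_def by blast
    then show ?thesis using nz by contradiction
  qed
qed

text \<open>\<open>c\<close> sits at \<open>v\<close> and \<open>\<eta>\<close> at \<open>u\<close> on two copies of the cycle
  \<open>\<theta>2 \<theta>1\<close>; only their different positions prevent a square.\<close>
definition locked :: "'a list \<Rightarrow> 'v \<Rightarrow> 'a list \<Rightarrow> 'v \<Rightarrow> 'a list \<Rightarrow> 'a list \<Rightarrow> 'a list \<Rightarrow> bool" where
  "locked h v c u \<theta>1 \<theta>2 \<eta> \<longleftrightarrow> walk v c v \<and> \<theta>2 @ \<theta>1 \<noteq> [] \<and> walk u \<theta>1 v \<and> walk v \<theta>2 u \<and> walk u \<eta> u \<and>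
     eqv h (c @ \<theta>2 @ \<theta>1 @ \<theta>2 @ \<eta> @ \<theta>1)"

text \<open>Otherwise \<open>c\<close> could be swapped into \<open>\<eta>\<close>, which makes the
  two copies of \<open>\<theta>1 @ \<theta>2\<close> adjacent.\<close>

lemma locked_base:
  assumes l: "locked h v c u \<theta>1 \<theta>2 \<eta>" and nz: "\<not> zero h"
  shows "v \<notin> src ` set \<eta>"
proof
  have w: "walk v c v" "\<theta>2 @ \<theta>1 \<noteq> []" "walk u \<theta>1 v" "walk v \<theta>2 u" "walk u \<eta> u"
    and e: "eqv h (c @ \<theta>2 @ \<theta>1 @ \<theta>2 @ \<eta> @ \<theta>1)" using l unfolding locked_def by blast+
  assume "v \<in> src ` set \<eta>"
  then obtain \<eta>1 \<eta>2 where \<eta>: "\<eta> = \<eta>1 @ \<eta>2" "walk u \<eta>1 v" "walk v \<eta>2 u" using walk_cut w(5) by blast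
  note e
  also have "eqv (c @ \<theta>2 @ \<theta>1 @ \<theta>2 @ \<eta> @ \<theta>1) (\<theta>2 @ \<theta>1 @ \<theta>2 @ \<eta>1 @ c @ \<eta>2 @ \<theta>1)"
    using eqv_swap[of v c "\<theta>2 @ \<theta>1 @ \<theta>2 @ \<eta>1" "\<eta>2 @ \<theta>1"] w \<eta> by (simp add: walk_appI)
  also have "eqv \<dots> ((\<theta>1 @ \<theta>2) @ (\<theta>1 @ \<theta>2) @ \<eta>1 @ c @ \<eta>2)"
    using eqv_rot2[of v "\<theta>2 @ \<theta>1 @ \<theta>2 @ \<eta>1 @ c @ \<eta>2" u \<theta>1] w \<eta> by (simp add: walk_appI)
  finally have "eqv h ((\<theta>1 @ \<theta>2) @ (\<theta>1 @ \<theta>2) @ \<eta>1 @ c @ \<eta>2)" .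
  moreover have "walk u (\<theta>1 @ \<theta>2) u" "walk u (\<eta>1 @ c @ \<eta>2) u" "\<theta>1 @ \<theta>2 \<noteq> []"
    using w \<eta> by (auto simp: walk_appI)
  ultimately show False using nz unfolding zero_def by blast
qed

text \<open>Rebasing \<open>c\<close> and both copies of the cycle at \<open>p\<close> gives another
  locked form with \<open>p\<close> in the role of \<open>v\<close>.\<close>

lemma locked_disjoint:
  assumes l: "locked h v c u \<theta>1 \<theta>2 \<eta>" and nz: "\<not> zero h"
    and p: "p \<in> src ` set c" "p \<in> src ` set (\<theta>2 @ \<theta>1)"
  shows "p \<notin> src ` set \<eta>"
proof -
  have w: "walk v c v" "\<theta>2 @ \<theta>1 \<noteq> []" "walk u \<theta>1 v" "walk v \<theta>2 u" "walk u \<eta> u"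
    and e: "eqv h (c @ \<theta>2 @ \<theta>1 @ \<theta>2 @ \<eta> @ \<theta>1)" using l unfolding locked_def by blast+
  obtain c1 c2 where c: "c = c1 @ c2" "walk v c1 p" "walk p c2 v" using walk_cut[OF w(1) p(1)] by blast
  consider "p \<in> src ` set \<theta>2" | "p \<in> src ` set \<theta>1" using p(2) by auto
  then show ?thesis
  proof cases
    case 1
    then obtain s q where t: "\<theta>2 = s @ q" "walk v s p" "walk p q u" using walk_cut[OF w(4)] by blast
    have "eqv h ((c2 @ c1) @ q @ (\<theta>1 @ s) @ q @ \<eta> @ (\<theta>1 @ s))"
      using eqv_trans[OF e] eqv_rebase3[of v c1 p c2 s "q @ \<theta>1" s "q @ \<eta> @ \<theta>1"] w c t by (simp add: walk_appI)
    then have "locked h p (c2 @ c1) u (\<theta>1 @ s) q \<eta>"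
      unfolding locked_def using w c t by (auto simp: walk_appI)
    then show ?thesis using locked_base nz by blast
  next
    case 2
    then obtain s q where t: "\<theta>1 = s @ q" "walk u s p" "walk p q v" using walk_cut[OF w(3)] by blast
    have "eqv h ((c2 @ c1) @ (q @ \<theta>2) @ s @ (q @ \<theta>2) @ \<eta> @ s)"
      using eqv_trans[OF e] eqv_rebase3[of v c1 p c2 "\<theta>2 @ s" q "\<theta>2 @ \<eta> @ s" q] w c t by (simp add: walk_appI)
    then have "locked h p (c2 @ c1) u s (q @ \<theta>2) \<eta>"
      unfolding locked_def using w c t by (auto simp: walk_appI)
    then show ?thesis using locked_base nz by blast
  qed
qed

text \<open>A repeated vertex gives a closed factor \<open>g\<close> of the cycle. If
  \<open>g\<close> lies within \<open>\<theta>1\<close> or \<open>\<theta>2\<close>, its two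
  occurrences can be made adjacent, a square. If it runs across the junction at \<open>u\<close>,
  one copy of \<open>g\<close> moves into \<open>\<eta>\<close> and the cycle gets shorter.\<close>

lemma locked_primitive:
  assumes "locked h v c u \<theta>1 \<theta>2 \<eta>" and nz: "\<not> zero h"
  shows "\<exists>u \<theta>1 \<theta>2 \<eta>. locked h v c u \<theta>1 \<theta>2 \<eta> \<and> distinct (map src (\<theta>2 @ \<theta>1))"
  using assms(1)
proof (induction "length (\<theta>2 @ \<theta>1)" arbitrary: u \<theta>1 \<theta>2 \<eta> rule: less_induct)
  case less
  have w: "walk v c v" "\<theta>2 @ \<theta>1 \<noteq> []" "walk u \<theta>1 v" "walk v \<theta>2 u" "walk u \<eta> u"
    and e: "eqv h (c @ \<theta>2 @ \<theta>1 @ \<theta>2 @ \<eta> @ \<theta>1)" using less.prems unfolding locked_def by blast+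
  have square: "\<not> eqv h (P @ g @ g @ S)" if "walk v P z" "walk z g z" "walk z S v" "g \<noteq> []" for P g S z
    using zero_square[OF that] nz zero_eqv by blast
  show ?case
  proof (cases "distinct (map src (\<theta>2 @ \<theta>1))")
    case True
    then show ?thesis using less.prems by blast
  next
    case False
    obtain s g q z where f: "\<theta>2 @ \<theta>1 = s @ g @ q" "walk v s z" "walk z g z" "walk z q v" "g \<noteq> []" "q \<noteq> []"
      using nondistinct_factor[OF walk_appI[OF w(4,3)] False] by blast
    from f(1) obtain us where "\<theta>2 = s @ us \<and> us @ \<theta>1 = g @ q \<or> \<theta>2 @ us = s \<and> \<theta>1 = us @ g @ q"
      by (auto simp: append_eq_append_conv2)
    then show ?thesis
    proof
      assume us: "\<theta>2 @ us = s \<and> \<theta>1 = us @ g @ q"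
      then have wu: "walk u us z" using w(4) f(2) walk_append_drop by blast
      note e
      also have "eqv (c @ \<theta>2 @ \<theta>1 @ \<theta>2 @ \<eta> @ \<theta>1) ((c @ s) @ g @ g @ (q @ \<theta>2 @ \<eta> @ us) @ q)"
        using eqv_swap_mid[of v "c @ s @ g" z "q @ \<theta>2 @ \<eta> @ us" g q] us wu w f eqv_sym by (auto simp: walk_appI)
      finally have "zero h"
        using square[of "c @ s" z g "(q @ \<theta>2 @ \<eta> @ us) @ q"] wu w f by (auto simp: walk_appI)
      then show ?thesis using nz by contradiction
    next
      assume us: "\<theta>2 = s @ us \<and> us @ \<theta>1 = g @ q"
      then have wu: "walk z us u" using w(4) f(2) walk_append_drop by blast
      from us obtain vs where "us = g @ vs \<and> vs @ \<theta>1 = q \<or> us @ vs = g \<and> \<theta>1 = vs @ q"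
        by (auto simp: append_eq_append_conv2)
      then show ?thesis
      proof
        assume vs: "us = g @ vs \<and> vs @ \<theta>1 = q"
        then have wv: "walk z vs u" using wu f(3) walk_append_drop by blast
        note e
        also have "eqv (c @ \<theta>2 @ \<theta>1 @ \<theta>2 @ \<eta> @ \<theta>1) ((c @ s) @ g @ g @ (q @ s) @ vs @ \<eta> @ \<theta>1)"
          using eqv_swap_mid[of v "c @ s @ g" z "q @ s" g "vs @ \<eta> @ \<theta>1"] us vs wv w f by (auto simp: walk_appI)
        finally have "zero h"
          using square[of "c @ s" z g "(q @ s) @ vs @ \<eta> @ \<theta>1"] wv w f by (auto simp: walk_appI)
        then show ?thesis using nz by contradiction
      next
        assume vs: "us @ vs = g \<and> \<theta>1 = vs @ q"
        then have wv: "walk u vs z" using wu f(3) walk_append_drop by blast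
        note e
        also have "eqv (c @ \<theta>2 @ \<theta>1 @ \<theta>2 @ \<eta> @ \<theta>1) (c @ s @ q @ s @ (g @ us @ \<eta> @ vs) @ q)"
          using eqv_swap_mid[of v "c @ s" z g "q @ s" "us @ \<eta> @ vs @ q"] us vs wu wv w f by (auto simp: walk_appI)
        finally have "locked h v c z q s (g @ us @ \<eta> @ vs)"
          unfolding locked_def using wu wv w f by (auto simp: walk_appI)
        moreover have "length (s @ q) < length (\<theta>2 @ \<theta>1)" using f(1,5) by simp
        ultimately show ?thesis using less.hyps by blast
      qed
    qed
  qed
qed

subsection \<open>The bound on excess visits\<close>

definition visits :: "'a list \<Rightarrow> 'v \<Rightarrow> nat" where
  "visits p v = count_list (map src p) v"

text \<open>The allowance of two visits per vertex becomes the summand \<open>2 * n\<close> of the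
  final bound.\<close>

definition excess :: "'a list \<Rightarrow> nat" where
  "excess p = (\<Sum>v\<in>src ` set p. visits p v - 2)"

text \<open>For the support of a closed walk this is its cyclomatic number minus one.\<close>
definition cyc :: "'a list \<Rightarrow> nat" where
  "cyc p = card (set p) - card (src ` set p)"

lemma visits_append [simp]: "visits (p @ q) v = visits p v + visits q v"
  by (simp add: visits_def)

lemma visits_eq_0_iff: "visits p v = 0 \<longleftrightarrow> v \<notin> src ` set p"
  by (simp add: visits_def count_list_0_iff)

lemma visits_mset: "mset p = mset q \<Longrightarrow> visits p v = visits q v"
  unfolding visits_def by (metis count_mset mset_map)

lemma visits_distinct:
  assumes "distinct (map src p)"
  shows "visits p v = (if v \<in> src ` set p then 1 else 0)"
  using assms by (induction p) (auto simp: visits_def count_list_0_iff)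

lemma sum_visits: "finite V \<Longrightarrow> src ` set p \<subseteq> V \<Longrightarrow> (\<Sum>v\<in>V. visits p v) = length p"
  unfolding visits_def using sum_count_set[of "map src p" V] by simp

lemma excess_superset:
  assumes "finite V" "src ` set p \<subseteq> V"
  shows "excess p = (\<Sum>v\<in>V. visits p v - 2)"
  unfolding excess_def by (rule sum.mono_neutral_left) (use assms in \<open>auto simp: visits_eq_0_iff[THEN iffD2]\<close>)

section \<open>Arrow and vertex counts of supports\<close>

lemma closed_walk_tgt:
  assumes "walk v p v" "f \<in> set p"
  shows "tgt f \<in> src ` set p"
proof -
  obtain p1 p2 where "p = p1 @ f # p2" using assms(2) by (meson split_list)
  then show ?thesis
    using cut_in_srcs[of v "p1 @ [f]" "tgt f" p2] assms(1) by (auto simp: walk_append)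
qed

text \<open>Arrows of \<open>S\<close> do not lead out of \<open>X\<close>, so the arrow by which
  the walk leaves \<open>X\<close> is outside \<open>S\<close>.\<close>

lemma walk_leaves:
  assumes "walk x p y" "x \<in> X" "y \<notin> X" "\<And>f. f \<in> set p \<Longrightarrow> src f \<in> X \<Longrightarrow> f \<in> S \<Longrightarrow> tgt f \<in> X"
  shows "\<exists>f\<in>set p. src f \<in> X \<and> f \<notin> S"
  using assms by (induction p arbitrary: x) auto

lemma walk_uncovered:
  assumes "walk x p y" "x \<in> src ` S" "\<not> set p \<subseteq> S" "\<And>f. f \<in> S \<Longrightarrow> tgt f \<in> src ` S"
  shows "\<exists>f\<in>set p. src f \<in> src ` S \<and> f \<notin> S"
  using assms by (induction p arbitrary: x) auto

text \<open>Arrows of \<open>c\<close> leaving new vertices match these vertices one to one, as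
  \<open>c\<close> leaves each vertex at most once. Only new arrows leaving old vertices change the
  difference.\<close>

lemma card_add_cycle:
  assumes S: "finite S" and c: "distinct (map src c)"
  shows "card (S \<union> set c) + card (src ` S) =
    card S + card (src ` (S \<union> set c)) + card {f \<in> set c. src f \<in> src ` S \<and> f \<notin> S}"
proof -
  let ?N = "{f \<in> set c. src f \<notin> src ` S}" and ?D = "{f \<in> set c. src f \<in> src ` S \<and> f \<notin> S}"
  have "card (S \<union> set c) = card (S \<union> (?N \<union> ?D))" by (rule arg_cong[where f=card]) auto
  also have "\<dots> = card S + card (?N \<union> ?D)" using S by (intro card_Un_disjoint) auto
  also have "card (?N \<union> ?D) = card ?N + card ?D" by (intro card_Un_disjoint) auto
  finally have 1: "card (S \<union> set c) = card S + (card ?N + card ?D)" .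
  have "card (src ` (S \<union> set c)) = card (src ` S \<union> src ` ?N)" by (rule arg_cong[where f=card]) auto
  also have "\<dots> = card (src ` S) + card (src ` ?N)"
    using S by (intro card_Un_disjoint) (auto, metis imageI)
  also have "card (src ` ?N) = card ?N"
    using c by (intro card_image) (auto simp: distinct_map inj_on_def)
  finally show ?thesis using 1 by simp
qed

lemma cyc_add_cycle:
  assumes "distinct (map src c)" "set h = set c \<union> set b"
  shows "cyc h = cyc b + card {f \<in> set c. src f \<in> src ` set b \<and> f \<notin> set b}"
  \<comment> \<open>\<open>card_image_le\<close> rules out truncation in the differences defining
    \<open>cyc\<close>.\<close>
  using card_add_cycle[of "set b" c] assms card_image_le[of "set b" src] card_image_le[of "set h" src]
  unfolding cyc_def by (simp add: Un_commute)

lemma visits_closed_twice: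
  assumes "walk v q v" "q \<noteq> []"
  shows "1 \<le> visits q v"
  using cut_in_srcs[of v "[]" v q] assms visits_eq_0_iff[of q v] by (auto simp: Suc_le_eq)

text \<open>The second conjunct strengthens the induction: if the remainder has \<open>cyc\<close>
  zero, adding a primitive cycle gives at most two visits per vertex and hence no excess.\<close>

lemma excess_bound:
  assumes prim: "\<And>c v. walk v c v \<Longrightarrow> c \<noteq> [] \<Longrightarrow> distinct (map src c) \<Longrightarrow> set c \<subseteq> A \<Longrightarrow> length c \<le> m"
    and "walk v h v" "h \<noteq> []" "set h \<subseteq> A" "\<not> zero h"
  shows "excess h \<le> m * (cyc h - 1) \<and> (cyc h = 0 \<longrightarrow> (\<forall>z. visits h z \<le> 1))"
  using assms(2-)
proof (induction "length h" arbitrary: h v rule: less_induct)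
  case less
  note h = less.prems
  show ?case
  proof (cases "distinct (map src h)")
    case True
    then have "visits h z \<le> 1" for z using visits_distinct by simp
    moreover from this have "visits h z - 2 = 0" for z
      by (metis diff_is_0_eq order_trans one_le_numeral)
    ultimately show ?thesis unfolding excess_def by simp
  next
    case False
    obtain c b u where cb: "eqv h (c @ b)" "c \<noteq> []" "walk u c u" "walk u b u" "distinct (map src c)"
      "\<not> set c \<subseteq> set b" using private_primitive_factor[OF h(1,2,4) False] by blast
    have "b \<noteq> []"
    proof
      assume "b = []"
      then have "mset (map src h) = mset (map src c)" using eqv_mset[OF cb(1)] by simp
      then show False using False cb(5) mset_eq_imp_distinct_iff by blast
    qed
    have hset: "set h = set c \<union> set b" using eqv_set[OF cb(1)] by simp
    have hlen: "length h = length c + length b" using eqv_length[OF cb(1)] by simp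
    have hvis: "visits h z = visits c z + visits b z" for z using visits_mset[OF eqv_mset[OF cb(1)]] by simp
    have cm: "length c \<le> m" using prim[OF cb(3,2,5)] hset h(3) by simp
    have vc: "visits c z \<le> 1" for z using visits_distinct[OF cb(5)] by simp
    let ?V = "src ` set h"
    have V: "finite ?V" "src ` set c \<subseteq> ?V" "src ` set b \<subseteq> ?V" using hset by auto
    show ?thesis
    proof (cases "zero b")
      case False
      \<comment> \<open>The remainder \<open>b\<close> is nonzero. Since \<open>c\<close> has an
        arrow outside \<open>b\<close>, some new arrow leaves the support of \<open>b\<close>; it
        raises \<open>cyc\<close> and pays for the at most \<open>m\<close> arrows of
        \<open>c\<close>.\<close>
      have "u \<in> src ` set b" using cut_in_srcs[of u "[]" u b] cb(4) \<open>b \<noteq> []\<close> by simp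
      then obtain f where "f \<in> set c" "src f \<in> src ` set b" "f \<notin> set b"
        using walk_uncovered[OF cb(3) _ cb(6)] closed_walk_tgt[OF cb(4)] by blast
      then have "card {f \<in> set c. src f \<in> src ` set b \<and> f \<notin> set b} \<noteq> 0" by (auto simp: card_eq_0_iff)
      then have cyc: "cyc b + 1 \<le> cyc h" using cyc_add_cycle[OF cb(5) hset] by linarith
      have IH: "excess b \<le> m * (cyc b - 1)" "cyc b = 0 \<Longrightarrow> visits b z \<le> 1" for z
        using less.hyps[of b u] hlen cb(2,4) \<open>b \<noteq> []\<close> False hset h(3) by auto
      show ?thesis
      proof (cases "cyc b = 0")
        case True
        have "visits h z - 2 = 0" for z using vc[of z] IH(2)[OF True, of z] hvis[of z] by simp
        then show ?thesis using cyc unfolding excess_def by simp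
      next
        case False
        have "excess h \<le> (\<Sum>z\<in>?V. (visits b z - 2) + visits c z)"
          unfolding excess_def by (rule sum_mono) (simp add: hvis)
        also have "\<dots> = excess b + length c"
          using excess_superset[OF V(1,3)] sum_visits[OF V(1,2)] by (simp add: sum.distrib)
        also have "\<dots> \<le> m * (cyc b - 1) + m * 1" using IH(1) cm by simp
        also have "\<dots> = m * cyc b" using False by (cases "cyc b") auto
        also have "\<dots> \<le> m * (cyc h - 1)" using cyc by (intro mult_le_mono2) linarith
        finally show ?thesis using cyc by simp
      qed
    next
      case True
      have "\<not> zero (c @ b)" using zero_eqv[OF cb(1)] h(4) by blast
      then obtain \<theta>1 \<theta>2 \<eta> p where "\<theta>2 @ \<theta>1 \<noteq> []" "walk p \<theta>1 u" "walk u \<theta>2 p" "walk p \<eta> p"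
        "eqv (c @ b) (c @ \<theta>2 @ \<theta>1 @ \<theta>2 @ \<eta> @ \<theta>1)"
        using zero_remainder[OF cb(3,4) \<open>b \<noteq> []\<close> _ True] by blast
      then have "locked h u c p \<theta>1 \<theta>2 \<eta>" unfolding locked_def using cb eqv_trans by blast
      then obtain p \<theta>1 \<theta>2 \<eta> where l: "locked h u c p \<theta>1 \<theta>2 \<eta>" and dw: "distinct (map src (\<theta>2 @ \<theta>1))"
        using locked_primitive[OF _ h(4)] by blast
      \<comment> \<open>\<open>w\<close> is the plain copy of the cycle and \<open>W\<close> the
        copy carrying \<open>\<eta>\<close>. The induction hypothesis is applied to
        \<open>W\<close>, after removing \<open>c\<close> and \<open>w\<close>.\<close>
      define w where "w = \<theta>2 @ \<theta>1"
      define W where "W = \<theta>2 @ \<eta> @ \<theta>1"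
      have t: "walk p \<theta>1 u" "walk u \<theta>2 p" "walk p \<eta> p" "w \<noteq> []" and e: "eqv h (c @ w @ W)"
        using l unfolding locked_def w_def W_def by auto
      have ww: "walk u w u" and WW: "walk u W u" unfolding w_def W_def using t by (auto simp: walk_appI)
      have dist_w: "distinct (map src w)" using dw w_def by simp
      have disj: "z \<notin> src ` set \<eta>" if "z \<in> src ` set c" "z \<in> src ` set w" for z
        using locked_disjoint[OF l h(4)] that unfolding w_def by blast
      have u_eta: "u \<notin> src ` set \<eta>" by (rule locked_base[OF l h(4)])
      have u_w: "u \<in> src ` set w" using cut_in_srcs[of u "[]" u w] ww t(4) by simp
      have vW: "visits W z = visits w z + visits \<eta> z" for z unfolding w_def W_def by simp
      have vh: "visits h z = visits c z + visits w z + visits W z" for z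
        using visits_mset[OF eqv_mset[OF e]] by simp
      have vw: "visits w z = (if z \<in> src ` set w then 1 else 0)" for z using visits_distinct[OF dist_w] .
      have Wset: "set W = set w \<union> set \<eta>" unfolding w_def W_def by auto
      have "mset (c @ b) = mset (c @ w @ W)" using eqv_mset[OF cb(1)] eqv_mset[OF e] by simp
      then have "mset b = mset (w @ W)" by simp
      then have "set b = set (w @ W)" by (rule mset_eq_setD)
      then have bW: "set b = set W" using Wset by auto
      have Wne: "W \<noteq> []" using t(4) unfolding w_def W_def by auto
      have wm: "length w \<le> m" using prim[OF ww t(4) dist_w] hset bW Wset h(3) by blast
      \<comment> \<open>If \<open>W\<close> were zero, \<open>zero_remainder\<close> with
        \<open>c @ w\<close> in front would force two visits of \<open>u\<close> in
        \<open>W\<close>; but \<open>w\<close> visits \<open>u\<close> once and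
        \<open>\<eta>\<close> never.\<close>
      have "\<not> zero W"
      proof
        assume "zero W"
        moreover have "\<not> zero ((c @ w) @ W)" using zero_eqv[OF e] h(4) by auto
        ultimately obtain \<phi>1 \<phi>2 \<zeta> y where \<phi>: "\<phi>2 @ \<phi>1 \<noteq> []" "walk y \<phi>1 u" "walk u \<phi>2 y"
          "eqv ((c @ w) @ W) ((c @ w) @ \<phi>2 @ \<phi>1 @ \<phi>2 @ \<zeta> @ \<phi>1)"
          using zero_remainder[OF walk_appI[OF cb(3) ww] WW Wne] by blast
        have "1 \<le> visits (\<phi>2 @ \<phi>1) u" using visits_closed_twice \<phi>(1-3) walk_appI by blast
        moreover have "visits W u = visits (\<phi>2 @ \<phi>1 @ \<phi>2 @ \<zeta> @ \<phi>1) u"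
          using eqv_mset[OF \<phi>(4)] by (intro visits_mset) simp
        ultimately have "2 \<le> visits W u" by simp
        moreover have "visits \<eta> u = 0" using u_eta by (simp add: visits_eq_0_iff)
        ultimately show False using vW[of u] vw[of u] by (simp split: if_splits)
      qed
      moreover have Wlen: "length W < length h" using eqv_length[OF e] cb(2) by simp
      ultimately have IH: "excess W \<le> m * (cyc W - 1)" "cyc W = 0 \<Longrightarrow> visits W z \<le> 1" for z
        using less.hyps[OF Wlen WW Wne] hset bW h(3) by auto
      have "\<eta> \<noteq> []"
      proof
        assume "\<eta> = []"
        then have "eqv h (c @ w @ w @ [])" using e unfolding w_def W_def by simp
        then show False using zero_square[OF cb(3) ww _ t(4)] zero_eqv h(4) by (metis walk.simps(1))
      qed
      then have "1 \<le> visits \<eta> p" using visits_closed_twice t(3) by blast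
      moreover have "p \<in> src ` set w"
        using cut_in_srcs[of u \<theta>2 p \<theta>1] t unfolding w_def by blast
      ultimately have "\<not> visits W p \<le> 1" using vW[of p] vw[of p] by simp
      then have cW: "1 \<le> cyc W" using IH(2) by (cases "cyc W") auto
      let ?D = "{f \<in> set c. src f \<in> src ` set W \<and> f \<notin> set W}"
      have hset': "set h = set c \<union> set W" using hset bW by simp
      have cyc: "cyc h = cyc W + card ?D" by (rule cyc_add_cycle[OF cb(5) hset'])
      have "u \<in> src ` set W" using u_w Wset by auto
      then obtain f where "f \<in> ?D"
        using walk_uncovered[OF cb(3), of "set W"] cb(6) bW closed_walk_tgt[OF WW] by blast
      then have "card ?D \<noteq> 0" by (auto simp: card_eq_0_iff)
      have V': "src ` set w \<subseteq> ?V" "src ` set W \<subseteq> ?V" using hset' Wset by auto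
      have "excess h \<le> excess W + m * card ?D"
      proof (cases "card ?D = 1")
        case False
        \<comment> \<open>Two new arrows leaving the support of \<open>W\<close> pay for both
          \<open>c\<close> and \<open>w\<close>.\<close>
        then have D: "2 \<le> card ?D" using \<open>card ?D \<noteq> 0\<close> by linarith
        have "excess h \<le> (\<Sum>z\<in>?V. (visits W z - 2) + visits c z + visits w z)"
          unfolding excess_def by (rule sum_mono) (simp add: vh)
        also have "\<dots> = excess W + length c + length w"
          using excess_superset[OF V(1) V'(2)] sum_visits[OF V(1,2)] sum_visits[OF V(1) V'(1)]
          by (simp add: sum.distrib)
        also have "\<dots> \<le> excess W + m * 2" using cm wm by simp
        also have "\<dots> \<le> excess W + m * card ?D" using D by (intro add_left_mono mult_le_mono2)
        finally show ?thesis .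
      next
        case True
        \<comment> \<open>With only one new departure, \<open>c\<close> cannot meet
          \<open>\<eta>\<close>: getting from \<open>u\<close> to \<open>\<eta>\<close> and back
          would need one such arrow in each half of \<open>c\<close>.\<close>
        have apart: "z \<notin> src ` set \<eta>" if zc: "z \<in> src ` set c" for z
        proof
          assume ze: "z \<in> src ` set \<eta>"
          obtain c1 c2 where c12: "c = c1 @ c2" "walk u c1 z" "walk z c2 u" using walk_cut[OF cb(3) zc] by blast
          have "\<exists>f\<in>set c1. src f \<in> src ` set w - src ` set \<eta> \<and> f \<notin> set W"
          proof (rule walk_leaves[OF c12(2)])
            fix f assume f: "f \<in> set c1" "src f \<in> src ` set w - src ` set \<eta>" "f \<in> set W"
            then have "f \<in> set w" using Wset by auto
            then have "tgt f \<in> src ` set w" using closed_walk_tgt[OF ww] by blast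
            moreover have "tgt f \<in> src ` set c" using closed_walk_tgt[OF cb(3)] f(1) c12(1) by simp
            ultimately show "tgt f \<in> src ` set w - src ` set \<eta>" using disj by blast
          qed (use u_w u_eta ze in auto)
          then obtain f1 where f1: "f1 \<in> set c1" "src f1 \<in> src ` set W" "f1 \<notin> set W" using Wset by auto
          have "\<exists>f\<in>set c2. src f \<in> src ` set \<eta> - src ` set w \<and> f \<notin> set W"
          proof (rule walk_leaves[OF c12(3)])
            fix f assume f: "f \<in> set c2" "src f \<in> src ` set \<eta> - src ` set w" "f \<in> set W"
            then have "f \<in> set \<eta>" using Wset by auto
            then have "tgt f \<in> src ` set \<eta>" using closed_walk_tgt[OF t(3)] by blast
            moreover have "tgt f \<in> src ` set c" using closed_walk_tgt[OF cb(3)] f(1) c12(1) by simp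
            ultimately show "tgt f \<in> src ` set \<eta> - src ` set w" using disj by blast
          qed (use u_eta ze zc disj in auto)
          then obtain f2 where f2: "f2 \<in> set c2" "src f2 \<in> src ` set W" "f2 \<notin> set W" using Wset by auto
          have "f1 \<noteq> f2" using f1(1) f2(1) cb(5) c12(1) by (auto simp: distinct_map)
          moreover have "card {f1, f2} \<le> card ?D" using f1 f2 c12(1) by (intro card_mono) auto
          ultimately show False using True by simp
        qed
        \<comment> \<open>At a vertex of \<open>c\<close>, each of \<open>c\<close>,
          \<open>w\<close> and \<open>W\<close> has at most one visit, so a third visit can be
          charged to \<open>w\<close>. Only \<open>length w\<close> has to be paid.\<close>
        have pointwise: "visits h z - 2 \<le> (visits W z - 2) + visits w z" for z
        proof (cases "z \<in> src ` set c")
          case True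
          then have "visits \<eta> z = 0" using apart by (simp add: visits_eq_0_iff)
          then show ?thesis using vh[of z] vW[of z] vw[of z] vc[of z] by (simp split: if_splits)
        next
          case False
          then have "visits c z = 0" by (simp add: visits_eq_0_iff)
          then show ?thesis using vh[of z] by simp
        qed
        have "excess h \<le> (\<Sum>z\<in>?V. (visits W z - 2) + visits w z)"
          unfolding excess_def by (rule sum_mono) (rule pointwise)
        also have "\<dots> = excess W + length w"
          using excess_superset[OF V(1) V'(2)] sum_visits[OF V(1) V'(1)] by (simp add: sum.distrib)
        finally show ?thesis using wm True by simp
      qed
      also have "\<dots> \<le> m * (cyc W - 1) + m * card ?D" using IH(1) by simp
      also have "\<dots> = m * (cyc h - 1)" using cW cyc by (simp add: distrib_left[symmetric])
      finally show ?thesis using cyc cW by simp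
    qed
  qed
qed

subsection \<open>Quivers\<close>

lemma walk_iff_nth:
  assumes "p \<noteq> []"
  shows "walk u p v \<longleftrightarrow>
    src (hd p) = u \<and> tgt (last p) = v \<and> (\<forall>i. Suc i < length p \<longrightarrow> tgt (p ! i) = src (p ! Suc i))"
  using assms
proof (induction p arbitrary: u rule: list_nonempty_induct)
  case (cons x xs)
  have "(\<forall>i. Suc i < length (x # xs) \<longrightarrow> tgt ((x # xs) ! i) = src ((x # xs) ! Suc i)) \<longleftrightarrow>
    tgt x = src (hd xs) \<and> (\<forall>i. Suc i < length xs \<longrightarrow> tgt (xs ! i) = src (xs ! Suc i))"
    (is "(\<forall>i. ?P i) \<longleftrightarrow> _")
  proof -
    have "(\<forall>i. ?P i) \<longleftrightarrow> ?P 0 \<and> (\<forall>i. ?P (Suc i))" by (metis not0_implies_Suc)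
    then show ?thesis using cons.hyps by (simp add: hd_conv_nth)
  qed
  then show ?case using cons by auto
qed auto

lemma closed_path_iff:
  "closed_path A src tgt p \<longleftrightarrow> p \<noteq> [] \<and> set p \<subseteq> A \<and> walk (src (hd p)) p (src (hd p))"
  unfolding closed_path_def is_path_def by (auto simp: walk_iff_nth)

lemma closed_pathI: "walk v p v \<Longrightarrow> p \<noteq> [] \<Longrightarrow> set p \<subseteq> A \<Longrightarrow> closed_path A src tgt p \<and> src (hd p) = v"
  by (auto simp: closed_path_iff walk_iff_nth)

text \<open>The given relations concern nonempty paths: a swap with an empty first or second block
  is trivial, one with \<open>c\<close> empty is a rotation, and otherwise it is a transposition of
  three closed paths.\<close>

lemma eqv_imp_path_equiv:
  assumes "eqv a b" "a \<noteq> []" "set a \<subseteq> A"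
  shows "path_equiv A src tgt (Some a) (Some b)"
  using assms
proof (induction rule: eqv.induct)
  case (eqv_rot v a b)
  show ?case
  proof (cases "a = [] \<or> b = []")
    case True
    then show ?thesis by (auto simp: path_equiv_def)
  next
    case False
    then show ?thesis
      using equiv_gen.rot[of a b A src tgt] closed_pathI[of v "a @ b" A] eqv_rot
      by (auto simp: path_equiv_def)
  qed
next
  case (eqv_swap v a b c)
  consider "a = [] \<or> b = []" | "a \<noteq> []" "b \<noteq> []" "c = []" | "a \<noteq> []" "b \<noteq> []" "c \<noteq> []" by blast
  then show ?case
  proof cases
    case 1
    then show ?thesis by (auto simp: path_equiv_def)
  next
    case 2
    then show ?thesis
      using equiv_gen.rot[of a b A src tgt] closed_pathI[of v "a @ b" A] eqv_swap
      by (auto simp: path_equiv_def walk_appI)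
  next
    case 3
    let ?as = "[a, b, c]"
    have "equiv_gen A src tgt
      (Some (concat (map (\<lambda>i. ?as ! Transposition.transpose 0 1 i) [0..<length ?as]))) (Some (concat ?as))"
    proof (rule equiv_gen.perm[where v = v])
      show "\<forall>x\<in>set ?as. closed_path A src tgt x \<and> src (hd x) = v"
        using closed_pathI eqv_swap 3 by auto
      show "Transposition.transpose 0 1 permutes {..<length ?as}"
        by (rule permutes_swap_id) auto
    qed simp
    moreover have "concat (map (\<lambda>i. ?as ! Transposition.transpose 0 1 i) [0..<length ?as]) = b @ a @ c"
      by (simp add: upt_rec Transposition.transpose_def)
    ultimately have "equiv_gen A src tgt (Some (b @ a @ c)) (Some (a @ b @ c))" by simp
    then show ?thesis unfolding path_equiv_def by (blast intro: equivclp_sym)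
  qed
next
  case (eqv_trans a b c)
  then have "b \<noteq> []" "set b \<subseteq> A" using eqv_length eqv_set by fastforce+
  then show ?case using eqv_trans unfolding path_equiv_def by (blast intro: equivclp_trans)
qed

lemma zero_imp_path_equiv_None:
  assumes "zero h" "h \<noteq> []" "set h \<subseteq> A"
  shows "path_equiv A src tgt (Some h) None"
proof -
  obtain v a c where z: "a \<noteq> []" "walk v a v" "walk v c v" "eqv h (a @ a @ c)"
    using assms(1) unfolding zero_def by blast
  have A: "set a \<subseteq> A" "set c \<subseteq> A" using eqv_set[OF z(4)] assms(3) by auto
  have "equiv_gen A src tgt (Some (a @ a @ c)) None"
  proof (cases "c = []")
    case True
    then show ?thesis using equiv_gen.sq[of A src tgt a] closed_pathI z A by auto
  next
    case False
    then show ?thesis using equiv_gen.sq2[of A src tgt a c] closed_pathI[of v _ A] z A by simp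
  qed
  then show ?thesis
    using eqv_imp_path_equiv[OF z(4) assms(2,3)] unfolding path_equiv_def by (blast intro: equivclp_trans)
qed

section \<open>Primitive closed paths and \<open>mQ\<close>\<close>

lemma walk_map_src_tgt: "walk u p v \<Longrightarrow> map src p @ [v] = u # map tgt p"
  by (induction p arbitrary: u) auto

text \<open>The heads of a closed walk are its sources shifted cyclically by one.\<close>

lemma distinct_tgt_iff_src:
  assumes "walk v p v"
  shows "distinct (map tgt p) \<longleftrightarrow> distinct (map src p)"
proof -
  have "mset (map src p @ [v]) = mset (v # map tgt p)" using walk_map_src_tgt[OF assms] by simp
  then have "mset (map src p) = mset (map tgt p)" by simp
  then show ?thesis using mset_eq_imp_distinct_iff by metis
qed

lemma primitive_closed_path_iff:
  "primitive_closed_path A src tgt p \<longleftrightarrow> closed_path A src tgt p \<and> distinct (map tgt p)"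
proof (cases "closed_path A src tgt p")
  case True
  then have "src (hd p) \<in> tgt ` set p" unfolding closed_path_def is_path_def by auto
  then have pv: "path_verts src tgt p = tgt ` set p" unfolding path_verts_def by auto
  have "(\<forall>v\<in>tgt ` set p. card {i. i < length p \<and> tgt (p ! i) = v} = 1) \<longleftrightarrow> distinct (map tgt p)"
  proof
    assume a: "\<forall>v\<in>tgt ` set p. card {i. i < length p \<and> tgt (p ! i) = v} = 1"
    show "distinct (map tgt p)"
      unfolding distinct_conv_nth
    proof (intro allI impI)
      fix i j assume ij: "i < length (map tgt p)" "j < length (map tgt p)" "i \<noteq> j"
      then have "card {k. k < length p \<and> tgt (p ! k) = tgt (p ! i)} = 1" using a by auto
      then obtain k where k: "{k. k < length p \<and> tgt (p ! k) = tgt (p ! i)} = {k}"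
        by (rule card_1_singletonE)
      show "map tgt p ! i \<noteq> map tgt p ! j"
      proof
        assume "map tgt p ! i = map tgt p ! j"
        then have "i \<in> {k}" "j \<in> {k}" unfolding k[symmetric] using ij by auto
        then show False using ij(3) by simp
      qed
    qed
  next
    assume d: "distinct (map tgt p)"
    show "\<forall>v\<in>tgt ` set p. card {i. i < length p \<and> tgt (p ! i) = v} = 1"
    proof
      fix v assume "v \<in> tgt ` set p"
      then obtain j where j: "j < length p" "v = tgt (p ! j)" by (auto simp: in_set_conv_nth)
      then have "{i. i < length p \<and> tgt (p ! i) = v} = {j}"
        using d by (auto simp: distinct_conv_nth)
      then show "card {i. i < length p \<and> tgt (p ! i) = v} = 1" by simp
    qed
  qed
  then show ?thesis using True unfolding primitive_closed_path_def pv by blast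
qed (simp add: primitive_closed_path_def)

lemma primitive_length_le:
  assumes "quiver V A src tgt" "primitive_closed_path A src tgt p"
  shows "length p \<le> card V"
proof -
  have "distinct (map tgt p)" "set p \<subseteq> A"
    using assms(2) unfolding primitive_closed_path_iff closed_path_iff by auto
  then have "length p = card (tgt ` set p)" using distinct_card[of "map tgt p"] by simp
  also have "\<dots> \<le> card V"
    using assms(1) \<open>set p \<subseteq> A\<close> unfolding quiver_def by (intro card_mono) auto
  finally show ?thesis .
qed

lemma finite_primitive:
  assumes "quiver V A src tgt"
  shows "finite {p. primitive_closed_path A src tgt p}"
proof (rule finite_subset)
  show "{p. primitive_closed_path A src tgt p} \<subseteq> {p. set p \<subseteq> A \<and> length p \<le> card V}"
    using primitive_length_le[OF assms] unfolding primitive_closed_path_iff closed_path_iff by auto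
  show "finite {p. set p \<subseteq> A \<and> length p \<le> card V}"
    using assms unfolding quiver_def by (intro finite_lists_length_le) auto
qed

lemma primitive_length_le_mQ:
  assumes "quiver V A src tgt" "walk v c v" "c \<noteq> []" "distinct (map src c)" "set c \<subseteq> A"
  shows "length c \<le> mQ A src tgt"
proof -
  have "primitive_closed_path A src tgt c"
    using closed_pathI[OF assms(2,3,5)] distinct_tgt_iff_src[OF assms(2)] assms(4)
    by (simp add: primitive_closed_path_iff)
  then show ?thesis unfolding mQ_def using finite_primitive[OF assms(1)] by (intro Max_ge) auto
qed

text \<open>The closed walk \<open>h\<close> supplies a primitive closed path, so the maximum is
  taken over a nonempty set.\<close>

lemma mQ_le_card:
  assumes "quiver V A src tgt" "walk v h v" "h \<noteq> []" "set h \<subseteq> A"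
  shows "mQ A src tgt \<le> card V"
proof -
  obtain \<alpha> c \<beta> t where c: "h = \<alpha> @ c @ \<beta>" "walk t c t" "c \<noteq> []" "distinct (map src c)"
    using primitive_factor[OF assms(2,3)] by metis
  then have "primitive_closed_path A src tgt c"
    using closed_pathI[OF c(2,3)] distinct_tgt_iff_src[OF c(2)] assms(4)
    by (simp add: primitive_closed_path_iff)
  then have "length ` {p. primitive_closed_path A src tgt p} \<noteq> {}" by blast
  then show ?thesis
    unfolding mQ_def using finite_primitive[OF assms(1)] primitive_length_le[OF assms(1)]
    by (subst Max_le_iff) auto
qed

section \<open>From excess visits to the length bound\<close>

lemma strongly_connected_srcs:
  assumes "quiver V A src tgt" "strongly_connected V A src tgt"
  shows "V = src ` A"
proof
  obtain p where p: "closed_path A src tgt p" "V \<subseteq> path_verts src tgt p"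
    using assms(2) unfolding strongly_connected_def by blast
  then have w: "walk (src (hd p)) p (src (hd p))" "p \<noteq> []" "set p \<subseteq> A" unfolding closed_path_iff by auto
  have "path_verts src tgt p \<subseteq> src ` set p"
    unfolding path_verts_def using closed_walk_tgt[OF w(1)] w(2) by auto
  then show "V \<subseteq> src ` A" using p(2) w(3) by blast
  show "src ` A \<subseteq> V" using assms(1) unfolding quiver_def by blast
qed

text \<open>Every source outside the support of \<open>h\<close> is left by an arrow outside
  \<open>h\<close>, so arrows minus sources cannot decrease from \<open>h\<close> to
  \<open>A\<close>.\<close>

lemma cyc_le:
  assumes "finite A" "set h \<subseteq> A"
  shows "card (src ` A) + cyc h \<le> card A"
proof -
  have "card (src ` A) \<le> card (src ` set h \<union> src ` (A - set h))"
    using assms by (intro card_mono) auto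
  also have "\<dots> \<le> card (src ` set h) + card (src ` (A - set h))" by (rule card_Un_le)
  also have "card (src ` (A - set h)) \<le> card (A - set h)" using assms by (intro card_image_le) auto
  finally have "card (src ` A) \<le> card (src ` set h) + card (A - set h)" by simp
  moreover have "card (A - set h) = card A - card (set h)" "card (set h) \<le> card A"
    using assms by (auto intro: card_Diff_subset card_mono)
  moreover have "card (src ` set h) \<le> card (set h)" by (intro card_image_le) auto
  ultimately show ?thesis unfolding cyc_def by linarith
qed

lemma length_bound:
  assumes Q: "quiver V A src tgt" "strongly_connected V A src tgt"
    and h: "walk v h v" "h \<noteq> []" "set h \<subseteq> A" "\<not> zero h"
  shows "int (length h) \<le> int (mQ A src tgt) * (int (card A) - int (card V) - 1) + 2 * int (card V)"
proof -
  let ?m = "mQ A src tgt"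
  have fin: "finite V" "finite A" using Q(1) unfolding quiver_def by auto
  have VA: "V = src ` A" by (rule strongly_connected_srcs[OF Q])
  have c: "card V + cyc h \<le> card A" using cyc_le[OF fin(2) h(3)] VA by simp
  have mn: "?m \<le> card V" by (rule mQ_le_card[OF Q(1) h(1-3)])
  have sV: "src ` set h \<subseteq> V" using VA h(3) by auto
  have len: "length h = (\<Sum>z\<in>V. visits h z)" using sum_visits[OF fin(1) sV] by simp
  have ex: "excess h \<le> ?m * (cyc h - 1)" "cyc h = 0 \<Longrightarrow> visits h z \<le> 1" for z
    using excess_bound[of A ?m v h] primitive_length_le_mQ[OF Q(1)] h by auto
  show ?thesis
  proof (cases "cyc h = 0")
    case True
    \<comment> \<open>Here the factor \<open>card A - card V - 1\<close> can be as small as -1. The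
      loss of \<open>?m\<close> is at most \<open>card V\<close>, which the absence of second visits
      makes up for.\<close>
    have "length h \<le> card V" unfolding len using sum_mono[of V "visits h" "\<lambda>_. 1"] ex(2)[OF True] by simp
    moreover have "int ?m * (-1) \<le> int ?m * (int (card A) - int (card V) - 1)"
      using c by (intro mult_left_mono) auto
    ultimately show ?thesis using mn by linarith
  next
    case False
    have "length h \<le> (\<Sum>z\<in>V. 2 + (visits h z - 2))" unfolding len by (rule sum_mono) simp
    also have "\<dots> = 2 * card V + excess h" unfolding excess_superset[OF fin(1) sV] sum.distrib by simp
    finally have "length h \<le> 2 * card V + ?m * (cyc h - 1)" using ex(1) by linarith
    then have "int (length h) \<le> 2 * int (card V) + int ?m * (int (cyc h) - 1)"
      using False by (cases "cyc h") (simp_all flip: of_nat_mult of_nat_add)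
    moreover have "int ?m * (int (cyc h) - 1) \<le> int ?m * (int (card A) - int (card V) - 1)"
      using c by (intro mult_left_mono) auto
    ultimately show ?thesis by linarith
  qed
qed

end

theorem theorem5p1:
  fixes V :: "'v set" and A :: "'a set" and src tgt :: "'a \<Rightarrow> 'v"
    and n d m :: nat and h :: "'a list"
  assumes "infinite (UNIV :: 'k::field set)" and "CHAR('k) = 2"
    and "in_Qndm V A src tgt n d m"
    and "closed_path A src tgt h"
    and "\<not> path_equiv A src tgt (Some h) None"
  shows "int (length h) \<le> int m * (int d - int n - 1) + 2 * int n"
proof -
  interpret quiver_maps src tgt .
  have Q: "quiver V A src tgt" "strongly_connected V A src tgt" and "card V = n" "card A = d" "mQ A src tgt = m"
    using assms(3) unfolding in_Qndm_def by auto
  have h: "walk (src (hd h)) h (src (hd h))" "h \<noteq> []" "set h \<subseteq> A"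
    using assms(4) unfolding closed_path_iff by auto
  \<comment> \<open>Rotations, swaps and squares are all available in the given equivalence, so a
    zero walk would be equivalent to the symbol 0.\<close>
  have "\<not> zero h" using zero_imp_path_equiv_None[OF _ h(2,3)] assms(5) by blast
  from length_bound[OF Q h this] show ?thesis
    using \<open>card V = n\<close> \<open>card A = d\<close> \<open>mQ A src tgt = m\<close> by simp
qed

end
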